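(* Let $p:X\times S\to[-\infty,\infty]$ be sublinear and let $g:H\times F\to[-\infty,\infty]$ be finite, semilinear, monotone and dominated by $p$ on $H\times F$. Let $\xi=\xi_{p,g}$ and $\xi_0=\xi_{0,p,g}$. (i) Suppose $X\times S$ is the hereditary face generated by $(H\times F)\cup\{(x,C):p(x,C)<\infty\}$ or, more generally, the hereditary face generated by $\{(x,C):\xi(x,C)<\infty\}$. Then $g$ has a finite Hahn-Banach extension $h$ on $X\times S$ if and only if there exists a finite superlinear map $\eta$ on $X\times S$ such that $\eta\le\xi$. If this condition is fulfilled, then $h$ can be chosen such that $\eta\le h\le\xi$. (ii) $g$ has a monotone Hahn-Banach extension $h$ on $X\times S$ if and only if there exists a superlinear map $\eta:X\times S\to(-\infty,\infty]$ such that $\eta\le\xi_0$. When this condition is fulfilled, $h$ can be chosen such that $\eta\le h\le\xi_0$ on $X\times S$. (iii) If the preordering on $X\times S$ is equality, then $g$ has a finite Hahn-Banach extension on $X\times S$ if and only if there exists a superlinear map $\eta:X\times S\to(-\infty,\infty]$ such that $\eta\le\xi_0$ and $g$ is cancellative.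
   Context: **Setting.** $\mathbb K$ is $\mathbb Q$, $\mathbb R$ or $\mathbb C$; $\mathbb K^*=\mathbb K\setminus\{0\}$, $\mathbb K_+=\mathbb K\cap(0,\infty)$; $\mathbf P$ is either $\mathbb K^*$ or $\mathbb K_+$. $X$ is a topological vector space over $\mathbb K$ and $S$ is a family of subsets of $X$, with an addition $\hat+$ on $S$ and a preorder $\le$ on $S$ (basic case: inclusion; more generally an abstract preorder), making $X\times S$ a $\mathbf P$-quasisemilinear preordered space, i.e.: (1) $\emptyset\in S$; (2) $(S,\hat+)$ is a commutative semigroup with zero element $\emptyset$; (3) $\le$ is reflexive and transitive, $A_1\le B_1$ and $A_2\le B_2$ imply $A_1\hat+A_2\le B_1\hat+B_2$, and $A\hat+B\le C\hat+B$ and $B\le G$ imply $A\hat+G\le C\hat+G$; (4) for $a,b\in\mathbf P$, $A,B\in S$: $aA\in S$, $a(A\hat+B)=aA\hat+aB$, $(ab)A=a(bA)$, $1A=A$; (5) $v+A\in S$ for $v\in X$, $A\in S$. The standing list also includes the properties (presented as consequences): (6) $aA=aB$ for some $a\in\mathbf P$ implies $A=B$; (7) $A\le B$ implies $aA\le aB$ for $a\in\mathbf P$; (8) $A\le A\hat+B$ if $0\in B$. On $X\times S$: $(x,A)+(y,B)=(x+y,A\hat+B)$, $a(x,A)=(ax,aA)$, and $(x,A)\le(y,B)$ iff $x=y$ and $A\le B$. For $k\in\mathbb N$, $k\circ A=A\hat+\cdots\hat+A$ ($k$ terms). $H$ is a linear subspace of $X$, and $F\subset S$ is a subfamily satisfying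 (1)–(8) with $H$ in place of $X$. **Maps.** A map $f$ with values in $[-\infty,\infty]$ on $X\times S$ is *sublinear* if (S1) $f(0,\emptyset)=0$; (S2) $f(v+x,v+A)=f(x,A)$ for all $v,x\in X$, $A\in S$; (S3) $f(x+y,\emptyset)\le f(x,\emptyset)+f(y,\emptyset)$; (S4) $f(0,A\hat+B)\le f(0,A)+f(0,B)$ (with $\infty+(-\infty)=\infty$); (S5) $f(0,aA)=af(0,A)$ for $a\in\mathbb K_+$. It is *superlinear* if (S1), (S2), (S5) hold and (S3), (S4) hold with $\ge$ in place of $\le$ (with $\infty+(-\infty)=-\infty$). It is *semilinear* if (S1), (S2), (S5) hold, $x\mapsto f(x,\emptyset)$ is linear, $f(0,A\hat+B)=f(0,A)+f(0,B)$, and $f$ takes at most one of the values $-\infty,\infty$. The same terms are used on $H\times F$ (with $H,F$ in place of $X,S$). In inequalities $\sum a_i\le\sum b_j$, $\infty-\infty$ means $-\infty$ on the left side and $\infty$ on the right side. $f$ is *monotone* if $(x,A)\le(y,B)$ implies $f(x,A)\le f(y,B)$. $g$ is *cancellative* if $g(x,A)=g(x,B)$ whenever $A\hat+C=B\hat+C$ for some $C\in S$. "Finite" means real-valued; "dominated by $p$" means $\le p$ on the domain. A *monotone Hahn-Banach extension* of $g$ is an extension $h:X\times S\to(-\infty,\infty]$ of $g$ that is semilinear, monotone and dominated by $p$; a *finite Hahn-Banach extension* is one with finite values. The *hereditary face* generated by $Q\subset X\times S$ is the set of $(x,A)\in X\times S$ for which there are $(y,B)\in X\times S$ and $(z,C)\in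 Q$ with $(x,A)+(y,B)\le(z,C)$. **Functions $\xi,\xi_0$.** A *test relation* for $(x,A)\in X\times S$ consists of $y+nx=l+m$ and $B\hat+n_1\circ(a_1A)\hat+\cdots\hat+n_k\circ(a_kA)\hat+C\le J\hat+G\hat+C$, with $m\in X$, $y,l\in H$, $B,J\in F$, $G,C\in S$, $k\in\mathbb N$, integers $n_i>0$, $a_i\in\mathbb K_+$, $n=n_1a_1+\cdots+n_ka_k$. It is *special* if $C=\emptyset$. Then $\xi(x,A)=\xi_{p,g}(x,A)$ (resp. $\xi_0(x,A)=\xi_{0,p,g}(x,A)$) is the infimum of $n^{-1}(p(m,G)+g(l,J)-g(y,B))$ over all test relations (resp. special test relations) for $(x,A)$.
   Formalization: The translate v+∅ is read as {v} (so S contains all singletons, and F those of H), and the addition is assumed to satisfy v+A={v}+̂A; without such a link the claim fails. Property (8) is required only for nonempty A. *)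

theory Defs
  imports "HOL-Analysis.Analysis"
begin

section \<open>Scalars\<close>

text \<open>
  The scalar field \<open>K\<close>, one of the rationals, the reals and the complex numbers, is a type \<open>'k\<close>
  together with a field isomorphism \<open>emb\<close> onto one of these three subfields of the complex numbers.
\<close>

definition scalar_embedding :: "('k::field \<Rightarrow> complex) \<Rightarrow> bool" where
  "scalar_embedding emb \<longleftrightarrow>
     emb 1 = 1 \<and> (\<forall>a b. emb (a + b) = emb a + emb b) \<and> (\<forall>a b. emb (a * b) = emb a * emb b) \<and>
     (range emb = \<rat> \<or> range emb = \<real> \<or> range emb = UNIV)"

definition pos_scalars :: "('k::field \<Rightarrow> complex) \<Rightarrow> 'k set" where
  "pos_scalars emb = {a. emb a \<in> \<real> \<and> 0 < Re (emb a)}"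

abbreviation scalar_val :: "('k::field \<Rightarrow> complex) \<Rightarrow> 'k \<Rightarrow> ereal" where
  "scalar_val emb a \<equiv> ereal (Re (emb a))"

text \<open>
  Addition is continuous by the sort of \<open>'x\<close>; the topology of \<open>K\<close> is that of the subspace
  \<open>range emb\<close> of the complex plane.
\<close>

definition topological_vector_space ::
    "('k::field \<Rightarrow> complex) \<Rightarrow> ('k \<Rightarrow> 'x::topological_ab_group_add \<Rightarrow> 'x) \<Rightarrow> bool" where
  "topological_vector_space emb scl \<longleftrightarrow>
     vector_space scl \<and>
     continuous_on (range emb \<times> UNIV) (\<lambda>(c, x). scl (inv emb c) x)"

section \<open>Quasisemilinear preordered spaces\<close>

text \<open>
  \<open>{}\<close> is the neutral element of the addition on the family of sets, so the translate \<open>v + {}\<close>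
  is \<open>{v}\<close>, in accordance with \<open>v + A = {v} + A\<close>. (With \<open>v + {} = {}\<close>, translation invariance would
  force \<open>f(x, {}) = f(0, {})\<close> for all the maps below; with \<open>v + {} = {v}\<close> it gives
  \<open>f(x, {}) = f(0, {-x})\<close>.)
\<close>

definition translate :: "'x::ab_group_add \<Rightarrow> 'x set \<Rightarrow> 'x set" where
  "translate v A = (if A = {} then {v} else (\<lambda>a. v + a) ` A)"

text \<open>
  \<open>X\<close> is a linear subspace of the ambient space, \<open>S\<close> the family of sets, \<open>P\<close> the set of admissible
  multipliers. The laws \<open>(ab)A = a(bA)\<close>, \<open>1A = A\<close> and \<open>scale_cancel\<close> hold automatically for dilations
  of sets in a vector space. \<open>le_plus\<close> is required for nonempty \<open>A\<close> only: for \<open>A = {}\<close>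
  it would say \<open>{} \<le> {0}\<close>, which would exclude equality as a preorder.
\<close>

locale quasisemilinear_preordered_space =
  fixes scl :: "'k::field \<Rightarrow> 'x::ab_group_add \<Rightarrow> 'x"
    and P :: "'k set"
    and splus :: "'x set \<Rightarrow> 'x set \<Rightarrow> 'x set"
    and le :: "'x set \<Rightarrow> 'x set \<Rightarrow> bool"
    and X :: "'x set"
    and S :: "'x set set"
  assumes empty_mem: "{} \<in> S"
    and plus_closed: "\<lbrakk>A \<in> S; B \<in> S\<rbrakk> \<Longrightarrow> splus A B \<in> S"
    and plus_assoc: "\<lbrakk>A \<in> S; B \<in> S; C \<in> S\<rbrakk> \<Longrightarrow> splus (splus A B) C = splus A (splus B C)"
    and plus_commute: "\<lbrakk>A \<in> S; B \<in> S\<rbrakk> \<Longrightarrow> splus A B = splus B A"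
    and plus_empty: "A \<in> S \<Longrightarrow> splus A {} = A"
    and le_refl: "A \<in> S \<Longrightarrow> le A A"
    and le_trans: "\<lbrakk>A \<in> S; B \<in> S; C \<in> S; le A B; le B C\<rbrakk> \<Longrightarrow> le A C"
    and plus_mono: "\<lbrakk>A1 \<in> S; B1 \<in> S; A2 \<in> S; B2 \<in> S; le A1 B1; le A2 B2\<rbrakk>
                      \<Longrightarrow> le (splus A1 A2) (splus B1 B2)"
    and le_exchange: "\<lbrakk>A \<in> S; B \<in> S; C \<in> S; G \<in> S; le (splus A B) (splus C B); le B G\<rbrakk>
                      \<Longrightarrow> le (splus A G) (splus C G)"
    and scale_closed: "\<lbrakk>a \<in> P; A \<in> S\<rbrakk> \<Longrightarrow> scl a ` A \<in> S"
    and scale_plus: "\<lbrakk>a \<in> P; A \<in> S; B \<in> S\<rbrakk>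
                      \<Longrightarrow> scl a ` splus A B = splus (scl a ` A) (scl a ` B)"
    and scale_scale: "\<lbrakk>a \<in> P; b \<in> P; A \<in> S\<rbrakk> \<Longrightarrow> scl (a * b) ` A = scl a ` scl b ` A"
    and scale_one: "A \<in> S \<Longrightarrow> scl 1 ` A = A"
    and translate_closed: "\<lbrakk>v \<in> X; A \<in> S\<rbrakk> \<Longrightarrow> translate v A \<in> S"
    and translate_plus: "\<lbrakk>v \<in> X; A \<in> S\<rbrakk> \<Longrightarrow> translate v A = splus {v} A"
    and scale_cancel: "\<lbrakk>a \<in> P; A \<in> S; B \<in> S; scl a ` A = scl a ` B\<rbrakk> \<Longrightarrow> A = B"
    and scale_mono: "\<lbrakk>a \<in> P; A \<in> S; B \<in> S; le A B\<rbrakk> \<Longrightarrow> le (scl a ` A) (scl a ` B)"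
    and le_plus: "\<lbrakk>A \<in> S; B \<in> S; A \<noteq> {}; 0 \<in> B\<rbrakk> \<Longrightarrow> le A (splus A B)"

definition pair_le :: "('x set \<Rightarrow> 'x set \<Rightarrow> bool) \<Rightarrow> 'x \<times> 'x set \<Rightarrow> 'x \<times> 'x set \<Rightarrow> bool" where
  "pair_le le u v \<longleftrightarrow> fst u = fst v \<and> le (snd u) (snd v)"

definition pair_plus ::
    "('x set \<Rightarrow> 'x set \<Rightarrow> 'x set) \<Rightarrow> 'x::ab_group_add \<times> 'x set \<Rightarrow> 'x \<times> 'x set \<Rightarrow> 'x \<times> 'x set" where
  "pair_plus splus u v = (fst u + fst v, splus (snd u) (snd v))"

definition hereditary_face ::
    "('x set \<Rightarrow> 'x set \<Rightarrow> 'x set) \<Rightarrow> ('x set \<Rightarrow> 'x set \<Rightarrow> bool) \<Rightarrow> 'x::ab_group_add set \<Rightarrow> 'x set set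
       \<Rightarrow> ('x \<times> 'x set) set \<Rightarrow> ('x \<times> 'x set) set" where
  "hereditary_face splus le X S Q =
     {u \<in> X \<times> S. \<exists>v \<in> X \<times> S. \<exists>w \<in> Q. pair_le le (pair_plus splus u v) w}"

section \<open>Maps on \<open>X \<times> S\<close>\<close>

text \<open>
  In \<^typ>\<open>ereal\<close> one has \<open>\<infinity> + (-\<infinity>) = \<infinity>\<close>, as required for sublinear maps; \<open>lower_add\<close> is the addition
  with \<open>\<infinity> + (-\<infinity>) = -\<infinity>\<close>, which is used for superlinear maps.
\<close>

definition lower_add :: "ereal \<Rightarrow> ereal \<Rightarrow> ereal" where
  "lower_add a b = - ((- a) + (- b))"

definition invariant_homogeneous ::
    "('k::field \<Rightarrow> complex) \<Rightarrow> ('k \<Rightarrow> 'x::ab_group_add \<Rightarrow> 'x)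
       \<Rightarrow> 'x set \<Rightarrow> 'x set set \<Rightarrow> ('x \<Rightarrow> 'x set \<Rightarrow> ereal) \<Rightarrow> bool" where
  "invariant_homogeneous emb scl X S f \<longleftrightarrow>
     f 0 {} = 0 \<and>
     (\<forall>v\<in>X. \<forall>x\<in>X. \<forall>A\<in>S. f (v + x) (translate v A) = f x A) \<and>
     (\<forall>a\<in>pos_scalars emb. \<forall>A\<in>S. f 0 (scl a ` A) = scalar_val emb a * f 0 A)"

definition sublinear ::
    "('k::field \<Rightarrow> complex) \<Rightarrow> ('k \<Rightarrow> 'x::ab_group_add \<Rightarrow> 'x) \<Rightarrow> ('x set \<Rightarrow> 'x set \<Rightarrow> 'x set)
       \<Rightarrow> 'x set \<Rightarrow> 'x set set \<Rightarrow> ('x \<Rightarrow> 'x set \<Rightarrow> ereal) \<Rightarrow> bool" where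
  "sublinear emb scl splus X S f \<longleftrightarrow>
     invariant_homogeneous emb scl X S f \<and>
     (\<forall>x\<in>X. \<forall>y\<in>X. f (x + y) {} \<le> f x {} + f y {}) \<and>
     (\<forall>A\<in>S. \<forall>B\<in>S. f 0 (splus A B) \<le> f 0 A + f 0 B)"

definition superlinear ::
    "('k::field \<Rightarrow> complex) \<Rightarrow> ('k \<Rightarrow> 'x::ab_group_add \<Rightarrow> 'x) \<Rightarrow> ('x set \<Rightarrow> 'x set \<Rightarrow> 'x set)
       \<Rightarrow> 'x set \<Rightarrow> 'x set set \<Rightarrow> ('x \<Rightarrow> 'x set \<Rightarrow> ereal) \<Rightarrow> bool" where
  "superlinear emb scl splus X S f \<longleftrightarrow>
     invariant_homogeneous emb scl X S f \<and>
     (\<forall>x\<in>X. \<forall>y\<in>X. lower_add (f x {}) (f y {}) \<le> f (x + y) {}) \<and>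
     (\<forall>A\<in>S. \<forall>B\<in>S. lower_add (f 0 A) (f 0 B) \<le> f 0 (splus A B))"

text \<open>Since the maps take extended real values, linearity refers to the real scalars in \<open>K\<close>.\<close>

definition real_linear ::
    "('k::field \<Rightarrow> complex) \<Rightarrow> ('k \<Rightarrow> 'x::ab_group_add \<Rightarrow> 'x) \<Rightarrow> 'x set \<Rightarrow> ('x \<Rightarrow> ereal) \<Rightarrow> bool" where
  "real_linear emb scl X \<phi> \<longleftrightarrow>
     (\<forall>x\<in>X. \<bar>\<phi> x\<bar> \<noteq> \<infinity>) \<and>
     (\<forall>x\<in>X. \<forall>y\<in>X. \<phi> (x + y) = \<phi> x + \<phi> y) \<and>
     (\<forall>a. emb a \<in> \<real> \<longrightarrow> (\<forall>x\<in>X. \<phi> (scl a x) = scalar_val emb a * \<phi> x))"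

definition semilinear ::
    "('k::field \<Rightarrow> complex) \<Rightarrow> ('k \<Rightarrow> 'x::ab_group_add \<Rightarrow> 'x) \<Rightarrow> ('x set \<Rightarrow> 'x set \<Rightarrow> 'x set)
       \<Rightarrow> 'x set \<Rightarrow> 'x set set \<Rightarrow> ('x \<Rightarrow> 'x set \<Rightarrow> ereal) \<Rightarrow> bool" where
  "semilinear emb scl splus X S f \<longleftrightarrow>
     invariant_homogeneous emb scl X S f \<and>
     real_linear emb scl X (\<lambda>x. f x {}) \<and>
     (\<forall>A\<in>S. \<forall>B\<in>S. f 0 (splus A B) = f 0 A + f 0 B) \<and>
     ((\<forall>x\<in>X. \<forall>A\<in>S. f x A \<noteq> \<infinity>) \<or> (\<forall>x\<in>X. \<forall>A\<in>S. f x A \<noteq> -\<infinity>))"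

definition monotone_functional ::
    "('x set \<Rightarrow> 'x set \<Rightarrow> bool) \<Rightarrow> 'x set \<Rightarrow> 'x set set \<Rightarrow> ('x \<Rightarrow> 'x set \<Rightarrow> ereal) \<Rightarrow> bool" where
  "monotone_functional le X S f \<longleftrightarrow>
     (\<forall>x\<in>X. \<forall>A\<in>S. \<forall>y\<in>X. \<forall>B\<in>S. pair_le le (x, A) (y, B) \<longrightarrow> f x A \<le> f y B)"

definition finite_map :: "'x set \<Rightarrow> 'x set set \<Rightarrow> ('x \<Rightarrow> 'x set \<Rightarrow> ereal) \<Rightarrow> bool" where
  "finite_map X S f \<longleftrightarrow> (\<forall>x\<in>X. \<forall>A\<in>S. \<bar>f x A\<bar> \<noteq> \<infinity>)"

definition above_minus_infinity :: "'x set \<Rightarrow> 'x set set \<Rightarrow> ('x \<Rightarrow> 'x set \<Rightarrow> ereal) \<Rightarrow> bool" where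
  "above_minus_infinity X S f \<longleftrightarrow> (\<forall>x\<in>X. \<forall>A\<in>S. f x A \<noteq> -\<infinity>)"

definition dominated ::
    "'x set \<Rightarrow> 'x set set \<Rightarrow> ('x \<Rightarrow> 'x set \<Rightarrow> ereal) \<Rightarrow> ('x \<Rightarrow> 'x set \<Rightarrow> ereal) \<Rightarrow> bool" where
  "dominated X S f p \<longleftrightarrow> (\<forall>x\<in>X. \<forall>A\<in>S. f x A \<le> p x A)"

definition cancellative ::
    "('x set \<Rightarrow> 'x set \<Rightarrow> 'x set) \<Rightarrow> 'x set set \<Rightarrow> 'x set \<Rightarrow> 'x set set
       \<Rightarrow> ('x \<Rightarrow> 'x set \<Rightarrow> ereal) \<Rightarrow> bool" where
  "cancellative splus S H F g \<longleftrightarrow>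
     (\<forall>x\<in>H. \<forall>A\<in>F. \<forall>B\<in>F. (\<exists>C\<in>S. splus A C = splus B C) \<longrightarrow> g x A = g x B)"

section \<open>Hahn-Banach extensions\<close>

text \<open>From here on the ambient space is the whole type \<open>'x\<close>.\<close>

definition monotone_HB_extension ::
    "('k::field \<Rightarrow> complex) \<Rightarrow> ('k \<Rightarrow> 'x::ab_group_add \<Rightarrow> 'x) \<Rightarrow> ('x set \<Rightarrow> 'x set \<Rightarrow> 'x set)
       \<Rightarrow> ('x set \<Rightarrow> 'x set \<Rightarrow> bool) \<Rightarrow> 'x set set \<Rightarrow> 'x set \<Rightarrow> 'x set set
       \<Rightarrow> ('x \<Rightarrow> 'x set \<Rightarrow> ereal) \<Rightarrow> ('x \<Rightarrow> 'x set \<Rightarrow> ereal) \<Rightarrow> ('x \<Rightarrow> 'x set \<Rightarrow> ereal) \<Rightarrow> bool" where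
  "monotone_HB_extension emb scl splus le S H F p g h \<longleftrightarrow>
     (\<forall>x\<in>H. \<forall>A\<in>F. h x A = g x A) \<and>
     above_minus_infinity UNIV S h \<and>
     semilinear emb scl splus UNIV S h \<and>
     monotone_functional le UNIV S h \<and>
     dominated UNIV S h p"

definition finite_HB_extension ::
    "('k::field \<Rightarrow> complex) \<Rightarrow> ('k \<Rightarrow> 'x::ab_group_add \<Rightarrow> 'x) \<Rightarrow> ('x set \<Rightarrow> 'x set \<Rightarrow> 'x set)
       \<Rightarrow> ('x set \<Rightarrow> 'x set \<Rightarrow> bool) \<Rightarrow> 'x set set \<Rightarrow> 'x set \<Rightarrow> 'x set set
       \<Rightarrow> ('x \<Rightarrow> 'x set \<Rightarrow> ereal) \<Rightarrow> ('x \<Rightarrow> 'x set \<Rightarrow> ereal) \<Rightarrow> ('x \<Rightarrow> 'x set \<Rightarrow> ereal) \<Rightarrow> bool" where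
  "finite_HB_extension emb scl splus le S H F p g h \<longleftrightarrow>
     monotone_HB_extension emb scl splus le S H F p g h \<and> finite_map UNIV S h"

section \<open>Test relations\<close>

definition multiple :: "('x set \<Rightarrow> 'x set \<Rightarrow> 'x set) \<Rightarrow> nat \<Rightarrow> 'x set \<Rightarrow> 'x set" where
  "multiple splus k A = (splus A ^^ k) {}"

text \<open>
  The list \<open>[(n\<^sub>1, a\<^sub>1), \<dots>, (n\<^sub>k, a\<^sub>k)]\<close> stands for the multipliers of a test relation:
  \<open>weighted_sum\<close> is the sum of the sets \<open>n\<^sub>i \<circ> (a\<^sub>i A)\<close> and \<open>total_weight\<close> is \<open>n\<^sub>1 a\<^sub>1 + \<dots> + n\<^sub>k a\<^sub>k\<close>.
\<close>

definition weighted_sum ::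
    "('k \<Rightarrow> 'x \<Rightarrow> 'x) \<Rightarrow> ('x set \<Rightarrow> 'x set \<Rightarrow> 'x set) \<Rightarrow> (nat \<times> 'k) list \<Rightarrow> 'x set \<Rightarrow> 'x set" where
  "weighted_sum scl splus ts A =
     foldr splus (map (\<lambda>(n, a). multiple splus n (scl a ` A)) ts) {}"

definition total_weight :: "(nat \<times> 'k::field) list \<Rightarrow> 'k" where
  "total_weight ts = (\<Sum>(n, a)\<leftarrow>ts. of_nat n * a)"

definition test_relation ::
    "('k::field \<Rightarrow> complex) \<Rightarrow> ('k \<Rightarrow> 'x::ab_group_add \<Rightarrow> 'x) \<Rightarrow> ('x set \<Rightarrow> 'x set \<Rightarrow> 'x set)
       \<Rightarrow> ('x set \<Rightarrow> 'x set \<Rightarrow> bool) \<Rightarrow> 'x set set \<Rightarrow> 'x set \<Rightarrow> 'x set set \<Rightarrow> 'x \<Rightarrow> 'x set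
       \<Rightarrow> 'x \<Rightarrow> 'x \<Rightarrow> 'x \<Rightarrow> 'x set \<Rightarrow> 'x set \<Rightarrow> 'x set \<Rightarrow> 'x set \<Rightarrow> (nat \<times> 'k) list \<Rightarrow> bool" where
  "test_relation emb scl splus le S H F x A y l m B J G C ts \<longleftrightarrow>
     y \<in> H \<and> l \<in> H \<and> B \<in> F \<and> J \<in> F \<and> G \<in> S \<and> C \<in> S \<and>
     ts \<noteq> [] \<and> (\<forall>(n, a)\<in>set ts. 0 < n \<and> a \<in> pos_scalars emb) \<and>
     y + scl (total_weight ts) x = l + m \<and>
     le (splus (splus B (weighted_sum scl splus ts A)) C) (splus (splus J G) C)"

definition test_value ::
    "('k::field \<Rightarrow> complex) \<Rightarrow> ('x \<Rightarrow> 'x set \<Rightarrow> ereal) \<Rightarrow> ('x \<Rightarrow> 'x set \<Rightarrow> ereal)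
       \<Rightarrow> 'x \<Rightarrow> 'x \<Rightarrow> 'x \<Rightarrow> 'x set \<Rightarrow> 'x set \<Rightarrow> 'x set \<Rightarrow> (nat \<times> 'k) list \<Rightarrow> ereal" where
  "test_value emb p g y l m B J G ts =
     (p m G + g l J - g y B) / scalar_val emb (total_weight ts)"

definition xi ::
    "('k::field \<Rightarrow> complex) \<Rightarrow> ('k \<Rightarrow> 'x::ab_group_add \<Rightarrow> 'x) \<Rightarrow> ('x set \<Rightarrow> 'x set \<Rightarrow> 'x set)
       \<Rightarrow> ('x set \<Rightarrow> 'x set \<Rightarrow> bool) \<Rightarrow> 'x set set \<Rightarrow> 'x set \<Rightarrow> 'x set set
       \<Rightarrow> ('x \<Rightarrow> 'x set \<Rightarrow> ereal) \<Rightarrow> ('x \<Rightarrow> 'x set \<Rightarrow> ereal) \<Rightarrow> 'x \<Rightarrow> 'x set \<Rightarrow> ereal" where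
  "xi emb scl splus le S H F p g x A =
     Inf {test_value emb p g y l m B J G ts | y l m B J G C ts.
            test_relation emb scl splus le S H F x A y l m B J G C ts}"

definition xi0 ::
    "('k::field \<Rightarrow> complex) \<Rightarrow> ('k \<Rightarrow> 'x::ab_group_add \<Rightarrow> 'x) \<Rightarrow> ('x set \<Rightarrow> 'x set \<Rightarrow> 'x set)
       \<Rightarrow> ('x set \<Rightarrow> 'x set \<Rightarrow> bool) \<Rightarrow> 'x set set \<Rightarrow> 'x set \<Rightarrow> 'x set set
       \<Rightarrow> ('x \<Rightarrow> 'x set \<Rightarrow> ereal) \<Rightarrow> ('x \<Rightarrow> 'x set \<Rightarrow> ereal) \<Rightarrow> 'x \<Rightarrow> 'x set \<Rightarrow> ereal" where
  "xi0 emb scl splus le S H F p g x A =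
     Inf {test_value emb p g y l m B J G ts | y l m B J G ts.
            test_relation emb scl splus le S H F x A y l m B J G {} ts}"

end

theory Submission
  imports Defs
begin

text \<open>

  Translation invariance expresses every map \<open>f\<close> occurring here through its values at the origin,
  \<open>f(x, A) = f(0, -x + A)\<close>. The theorem is thus about additive, positively homogeneous functionals on the
  preordered commutative monoid \<open>S\<close>, on which the positive scalars act by automorphisms; the
  vector space enters only through the singletons, which are invertible up to \<open>{0}\<close>.

  On such a monoid the essential step is a sandwich theorem, \<open>additive_between\<close>. One looks at sets \<open>U\<close> of
  pairs \<open>(A, c)\<close>, each read as the requirement \<open>h(A) \<le> c\<close> on a functional \<open>h\<close> still to be found. The
  requirements that \<open>p\<close> and \<open>g\<close> impose form such a set, closed under addition and dilation, and the
  condition that \<open>\<eta>\<close> lies below \<open>\<xi>\<close> says precisely that \<open>\<eta>\<close> satisfies all of them. By Zorn's lemma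
  there is a maximal \<open>U\<close> with these properties. Maximality makes \<open>U\<close> absorb consequences: if a
  set \<open>T\<close> of lower bounds \<open>h(E) \<ge> s\<close> leaves \<open>\<eta>\<close> consistent with everything that follows from \<open>U\<close> and
  \<open>T\<close>, then \<open>(A + E, c + s) \<in> U\<close> already gives \<open>(A, c) \<in> U\<close>. This is used for two sets \<open>T\<close>: the lower
  bounds given by \<open>\<eta>\<close>, and then the lower bound \<open>h(B) \<ge> t\<close> where \<open>t\<close> is the best upper bound that \<open>U\<close>
  provides for \<open>B\<close>. The second use says that the best upper bound is superadditive; being
  subadditive by construction, it is additive.

  The weights \<open>n\<^sub>i a\<^sub>i\<close> in test relations reflect that \<open>(a + b)A\<close> need not be \<open>aA + bA\<close>: the best
  upper bound for \<open>A\<close> must take into account upper bounds for all sums of dilates of \<open>A\<close>.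

  Part (ii) is the sandwich theorem for the given preorder, and part (i) is the same theorem for the preorder
  \<open>\<exists>C\<in>S. A + C \<le> B + C\<close>, because a test relation is a special one for that preorder. The
  extension found in (i) exceeds \<open>-\<infinity>\<close> everywhere, and \<open>h(A) + h(B) \<le> h(C) < \<infinity>\<close> for the elements of
  a hereditary face makes it finite. In part (iii) the rule that \<open>A \<le> A + B\<close> for \<open>0 \<in> B\<close> and nonempty \<open>A\<close>
  becomes \<open>A = A + B\<close> and forces all nonempty members of \<open>S\<close> to be singletons; on these an additive
  functional above \<open>-\<infinity>\<close> is finite.
\<close>

section \<open>Upper bounds on a preordered monoid with dilations\<close>

text \<open>

  \<open>D\<close> is a commuting family of endomorphisms, each paired with the positive factor by which a homogeneous
  functional has to scale along it. Keeping the pairs abstract avoids any reference to the scalar field.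
\<close>

locale dilation_monoid =
  fixes S :: "'s set"
    and plus :: "'s \<Rightarrow> 's \<Rightarrow> 's" (infixl "\<oplus>" 65)
    and zero :: 's ("\<zero>")
    and le :: "'s \<Rightarrow> 's \<Rightarrow> bool" (infix "\<preceq>" 50)
    and D :: "(real \<times> ('s \<Rightarrow> 's)) set"
  assumes zero_mem [simp]: "\<zero> \<in> S"
    and plus_mem [simp]: "A \<in> S \<Longrightarrow> B \<in> S \<Longrightarrow> A \<oplus> B \<in> S"
    and assoc: "A \<in> S \<Longrightarrow> B \<in> S \<Longrightarrow> C \<in> S \<Longrightarrow> A \<oplus> B \<oplus> C = A \<oplus> (B \<oplus> C)"
    and commute: "A \<in> S \<Longrightarrow> B \<in> S \<Longrightarrow> A \<oplus> B = B \<oplus> A"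
    and plus_zero [simp]: "A \<in> S \<Longrightarrow> A \<oplus> \<zero> = A"
    and le_refl: "A \<in> S \<Longrightarrow> A \<preceq> A"
    and le_trans: "A \<in> S \<Longrightarrow> B \<in> S \<Longrightarrow> C \<in> S \<Longrightarrow> A \<preceq> B \<Longrightarrow> B \<preceq> C \<Longrightarrow> A \<preceq> C"
    and le_plus_mono: "A \<in> S \<Longrightarrow> A' \<in> S \<Longrightarrow> B \<in> S \<Longrightarrow> B' \<in> S \<Longrightarrow>
                       A \<preceq> A' \<Longrightarrow> B \<preceq> B' \<Longrightarrow> A \<oplus> B \<preceq> A' \<oplus> B'"
    and unit_D: "(1, id) \<in> D"
    and pos_D: "(n, \<phi>) \<in> D \<Longrightarrow> 0 < n"
    and mem_D: "(n, \<phi>) \<in> D \<Longrightarrow> A \<in> S \<Longrightarrow> \<phi> A \<in> S"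
    and plus_D: "(n, \<phi>) \<in> D \<Longrightarrow> A \<in> S \<Longrightarrow> B \<in> S \<Longrightarrow> \<phi> (A \<oplus> B) = \<phi> A \<oplus> \<phi> B"
    and zero_D: "(n, \<phi>) \<in> D \<Longrightarrow> \<phi> \<zero> = \<zero>"
    and mono_D: "(n, \<phi>) \<in> D \<Longrightarrow> A \<in> S \<Longrightarrow> B \<in> S \<Longrightarrow> A \<preceq> B \<Longrightarrow> \<phi> A \<preceq> \<phi> B"
    and commute_D: "(n, \<phi>) \<in> D \<Longrightarrow> (m, \<psi>) \<in> D \<Longrightarrow> A \<in> S \<Longrightarrow> \<phi> (\<psi> A) = \<psi> (\<phi> A)"
begin

lemma interchange:
  assumes "A \<in> S" "B \<in> S" "C \<in> S" "E \<in> S"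
  shows "(A \<oplus> B) \<oplus> (C \<oplus> E) = (A \<oplus> C) \<oplus> (B \<oplus> E)"
  using assms by (metis assoc commute plus_mem)

lemma right_commute: "A \<in> S \<Longrightarrow> B \<in> S \<Longrightarrow> C \<in> S \<Longrightarrow> A \<oplus> B \<oplus> C = A \<oplus> C \<oplus> B"
  by (metis assoc commute)

text \<open>

  \<open>W\<close> is the closure of \<open>D\<close> under sums and composites. Its members send \<open>A\<close> to a sum of dilates of \<open>A\<close>
  such as \<open>n\<^sub>1 \<circ> (a\<^sub>1 A) + \<dots> + n\<^sub>k \<circ> (a\<^sub>k A)\<close> and carry the total weight. Closure under
  composition is what allows two test relations with different weights to be brought to common ones.
\<close>

inductive_set W :: "(real \<times> ('s \<Rightarrow> 's)) set" where
  base: "(n, \<phi>) \<in> D \<Longrightarrow> (n, \<phi>) \<in> W"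
| sum: "(n, \<phi>) \<in> W \<Longrightarrow> (m, \<psi>) \<in> W \<Longrightarrow> (n + m, \<lambda>A. \<phi> A \<oplus> \<psi> A) \<in> W"
| comp: "(n, \<phi>) \<in> W \<Longrightarrow> (m, \<psi>) \<in> W \<Longrightarrow> (n * m, \<lambda>A. \<phi> (\<psi> A)) \<in> W"

lemma pos_W: "(n, \<phi>) \<in> W \<Longrightarrow> 0 < n"
  by (induction rule: W.induct) (auto dest: pos_D)

lemma mem_W: "(n, \<phi>) \<in> W \<Longrightarrow> A \<in> S \<Longrightarrow> \<phi> A \<in> S"
  by (induction arbitrary: A rule: W.induct) (auto dest: mem_D)

lemma plus_W: "(n, \<phi>) \<in> W \<Longrightarrow> A \<in> S \<Longrightarrow> B \<in> S \<Longrightarrow> \<phi> (A \<oplus> B) = \<phi> A \<oplus> \<phi> B"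
  by (induction arbitrary: A B rule: W.induct) (simp_all add: plus_D interchange mem_W)

lemma mono_W: "(n, \<phi>) \<in> W \<Longrightarrow> A \<in> S \<Longrightarrow> B \<in> S \<Longrightarrow> A \<preceq> B \<Longrightarrow> \<phi> A \<preceq> \<phi> B"
  by (induction arbitrary: A B rule: W.induct) (simp_all add: mono_D le_plus_mono mem_W)

lemma commute_W_D:
  "(n, \<phi>) \<in> W \<Longrightarrow> (m, \<psi>) \<in> D \<Longrightarrow> A \<in> S \<Longrightarrow> \<phi> (\<psi> A) = \<psi> (\<phi> A)"
  by (induction arbitrary: A rule: W.induct) (simp_all add: commute_D plus_D mem_W mem_D)

lemma commute_W:
  assumes "(m, \<psi>) \<in> W" "(n, \<phi>) \<in> W" "A \<in> S"
  shows "\<phi> (\<psi> A) = \<psi> (\<phi> A)"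
  using assms
  by (induction arbitrary: A rule: W.induct) (simp_all add: commute_W_D plus_W mem_W)

text \<open>

  A pair \<open>(A, c)\<close> stands for a one-sided bound \<open>c\<close> on the value of a functional at \<open>A\<close>: an upper bound
  in some sets, a lower bound in others. Additivity and homogeneity of the functional turn bounds into
  further bounds, and a wedge is closed under this.
\<close>

definition wedge :: "('s \<times> real) set \<Rightarrow> bool" where
  "wedge U \<longleftrightarrow> U \<subseteq> S \<times> UNIV \<and> (\<zero>, 0) \<in> U \<and>
     (\<forall>A c B d. (A, c) \<in> U \<longrightarrow> (B, d) \<in> U \<longrightarrow> (A \<oplus> B, c + d) \<in> U) \<and>
     (\<forall>n \<phi> A c. (n, \<phi>) \<in> D \<longrightarrow> (A, c) \<in> U \<longrightarrow> (\<phi> A, n * c) \<in> U)"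

lemma wedge_W: "(n, \<phi>) \<in> W \<Longrightarrow> wedge U \<Longrightarrow> (A, c) \<in> U \<Longrightarrow> (\<phi> A, n * c) \<in> U"
proof (induction arbitrary: A c rule: W.induct)
  case (sum n \<phi> m \<psi>)
  then show ?case by (simp add: wedge_def distrib_right)
next
  case (comp n \<phi> m \<psi>)
  from comp.IH(1)[OF comp.prems(1) comp.IH(2)[OF comp.prems]] show ?case
    by (simp add: mult.assoc)
qed (simp add: wedge_def)

text \<open>

  From \<open>h(A + E) \<le> c + s\<close>, known from the upper bounds \<open>U\<close>, and \<open>h(E) \<ge> s\<close>, known from the lower bounds
  \<open>T\<close>, there follows \<open>h(A) \<le> c\<close>. Writing the consequence in this way keeps all numbers finite.
\<close>

definition derived_bounds :: "('s \<times> real) set \<Rightarrow> ('s \<times> real) set \<Rightarrow> ('s \<times> real) set" where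
  "derived_bounds U T = {(A, c). A \<in> S \<and> (\<exists>E s. (E, s) \<in> T \<and> (A \<oplus> E, c + s) \<in> U)}"

lemma subset_derived_bounds:
  assumes "wedge U" "wedge T" shows "U \<subseteq> derived_bounds U T"
proof
  fix x assume x: "x \<in> U"
  obtain A c where "x = (A, c)" by fastforce
  with x assms show "x \<in> derived_bounds U T"
    unfolding derived_bounds_def wedge_def by (auto intro!: exI[of _ \<zero>] exI[of _ "0::real"])
qed

lemma wedge_derived_bounds:
  assumes U: "wedge U" and T: "wedge T" shows "wedge (derived_bounds U T)"
  unfolding wedge_def
proof (intro conjI allI impI)
  show "derived_bounds U T \<subseteq> S \<times> UNIV" by (auto simp: derived_bounds_def)
  show "(\<zero>, 0) \<in> derived_bounds U T" using subset_derived_bounds[OF U T] U by (auto simp: wedge_def)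
next
  fix A c B d assume "(A, c) \<in> derived_bounds U T" "(B, d) \<in> derived_bounds U T"
  then obtain E s E' s' where e: "(E, s) \<in> T" "(A \<oplus> E, c + s) \<in> U" "A \<in> S"
    "(E', s') \<in> T" "(B \<oplus> E', d + s') \<in> U" "B \<in> S"
    by (auto simp: derived_bounds_def)
  then have m: "E \<in> S" "E' \<in> S" using T by (auto simp: wedge_def)
  have "(E \<oplus> E', s + s') \<in> T" using T e by (auto simp: wedge_def)
  moreover have "((A \<oplus> E) \<oplus> (B \<oplus> E'), (c + s) + (d + s')) \<in> U"
    using U e by (auto simp: wedge_def)
  then have "((A \<oplus> B) \<oplus> (E \<oplus> E'), (c + d) + (s + s')) \<in> U"
    using m e by (simp add: interchange algebra_simps)
  ultimately show "(A \<oplus> B, c + d) \<in> derived_bounds U T" using e by (auto simp: derived_bounds_def)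
next
  fix n \<phi> A c assume d: "(n, \<phi>) \<in> D" and "(A, c) \<in> derived_bounds U T"
  then obtain E s where e: "(E, s) \<in> T" "(A \<oplus> E, c + s) \<in> U" "A \<in> S"
    by (auto simp: derived_bounds_def)
  then have m: "E \<in> S" using T by (auto simp: wedge_def)
  have "(\<phi> E, n * s) \<in> T" using T e d by (auto simp: wedge_def)
  moreover have "(\<phi> (A \<oplus> E), n * (c + s)) \<in> U" using U e d by (auto simp: wedge_def)
  then have "(\<phi> A \<oplus> \<phi> E, n * c + n * s) \<in> U" using d m e by (simp add: plus_D distrib_left)
  ultimately show "(\<phi> A, n * c) \<in> derived_bounds U T" using e d by (auto simp: derived_bounds_def mem_D)
qed

end

section \<open>A sandwich theorem\<close>

text \<open>

  The hypothesis \<open>consistent\<close> is \<open>\<eta> \<le> \<xi>\<close>, evaluated on the test relations in which \<open>A\<close> occurs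
  with weight one. These suffice, since a superlinear \<open>\<eta>\<close> passes from \<open>A\<close> to a sum
  of dilates of \<open>A\<close>.
\<close>

locale sandwich = dilation_monoid +
  fixes p \<eta> :: "'a \<Rightarrow> ereal" and F :: "'a set" and g :: "'a \<Rightarrow> real"
  assumes p_zero: "p \<zero> = 0"
    and p_plus: "A \<in> S \<Longrightarrow> B \<in> S \<Longrightarrow> p (A \<oplus> B) \<le> p A + p B"
    and p_D: "(n, \<phi>) \<in> D \<Longrightarrow> A \<in> S \<Longrightarrow> p (\<phi> A) \<le> ereal n * p A"
    and \<eta>_zero: "\<eta> \<zero> = 0"
    and \<eta>_plus: "A \<in> S \<Longrightarrow> B \<in> S \<Longrightarrow> \<eta> A + \<eta> B \<le> \<eta> (A \<oplus> B)"
    and \<eta>_D: "(n, \<phi>) \<in> D \<Longrightarrow> A \<in> S \<Longrightarrow> ereal n * \<eta> A \<le> \<eta> (\<phi> A)"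
    and \<eta>_above: "A \<in> S \<Longrightarrow> \<eta> A \<noteq> -\<infinity>"
    and F_sub: "F \<subseteq> S"
    and F_zero: "\<zero> \<in> F"
    and F_plus: "A \<in> F \<Longrightarrow> B \<in> F \<Longrightarrow> A \<oplus> B \<in> F"
    and F_D: "(n, \<phi>) \<in> D \<Longrightarrow> A \<in> F \<Longrightarrow> \<phi> A \<in> F"
    and g_zero: "g \<zero> = 0"
    and g_plus: "A \<in> F \<Longrightarrow> B \<in> F \<Longrightarrow> g (A \<oplus> B) = g A + g B"
    and g_D: "(n, \<phi>) \<in> D \<Longrightarrow> A \<in> F \<Longrightarrow> g (\<phi> A) = n * g A"
    and consistent: "A \<in> S \<Longrightarrow> B \<in> F \<Longrightarrow> G \<in> S \<Longrightarrow> J \<in> F \<Longrightarrow> A \<oplus> B \<preceq> G \<oplus> J \<Longrightarrow>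
                      \<eta> A \<le> p G + ereal (g J) - ereal (g B)"
begin

text \<open>
  The numerators \<open>p(G) + g(J) - g(B)\<close> of the values of the test relations, and all real numbers above them. As
  \<open>g\<close> is real, its values can be moved to the other side, which avoids \<open>\<infinity> - \<infinity>\<close>.
\<close>

definition test_bounds :: "('a \<times> real) set" where
  "test_bounds = {(A, c). A \<in> S \<and> (\<exists>G\<in>S. \<exists>B\<in>F. \<exists>J\<in>F.
     A \<oplus> B \<preceq> G \<oplus> J \<and> p G \<le> ereal (c - g J + g B))}"

lemma F_S: "B \<in> F \<Longrightarrow> B \<in> S"
  using F_sub by auto

lemma wedge_test_bounds: "wedge test_bounds"
  unfolding wedge_def
proof (intro conjI allI impI)
  show "test_bounds \<subseteq> S \<times> UNIV" by (auto simp: test_bounds_def)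
  show "(\<zero>, 0) \<in> test_bounds"
    using F_zero p_zero by (auto simp: test_bounds_def le_refl intro!: bexI[of _ \<zero>])
next
  fix A c A' c' assume "(A, c) \<in> test_bounds" "(A', c') \<in> test_bounds"
  then obtain G B J G' B' J' where *: "A \<in> S" "G \<in> S" "B \<in> F" "J \<in> F" "A \<oplus> B \<preceq> G \<oplus> J"
     "p G \<le> ereal (c - g J + g B)" "A' \<in> S" "G' \<in> S" "B' \<in> F" "J' \<in> F" "A' \<oplus> B' \<preceq> G' \<oplus> J'"
     "p G' \<le> ereal (c' - g J' + g B')"
    by (auto simp: test_bounds_def)
  then have s: "B \<in> S" "B' \<in> S" "J \<in> S" "J' \<in> S" by (auto dest: F_S)
  have "(A \<oplus> B) \<oplus> (A' \<oplus> B') \<preceq> (G \<oplus> J) \<oplus> (G' \<oplus> J')" using * s by (simp add: le_plus_mono)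
  then have "(A \<oplus> A') \<oplus> (B \<oplus> B') \<preceq> (G \<oplus> G') \<oplus> (J \<oplus> J')" using * s by (simp add: interchange)
  moreover have "p (G \<oplus> G') \<le> p G + p G'" using * by (simp add: p_plus)
  then have "p (G \<oplus> G') \<le> ereal (c + c' - g (J \<oplus> J') + g (B \<oplus> B'))"
    using add_mono[OF *(6) *(12)] * by (simp add: g_plus algebra_simps)
  ultimately show "(A \<oplus> A', c + c') \<in> test_bounds"
    unfolding test_bounds_def using * F_plus plus_mem by blast
next
  fix n \<phi> A c assume d: "(n, \<phi>) \<in> D" and "(A, c) \<in> test_bounds"
  then obtain G B J where *: "A \<in> S" "G \<in> S" "B \<in> F" "J \<in> F" "A \<oplus> B \<preceq> G \<oplus> J"
     "p G \<le> ereal (c - g J + g B)"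
    by (auto simp: test_bounds_def)
  then have s: "B \<in> S" "J \<in> S" by (auto dest: F_S)
  have "\<phi> (A \<oplus> B) \<preceq> \<phi> (G \<oplus> J)" using * s d mono_D by simp
  then have "\<phi> A \<oplus> \<phi> B \<preceq> \<phi> G \<oplus> \<phi> J" using * s d by (simp add: plus_D)
  moreover have "ereal n * p G \<le> ereal n * ereal (c - g J + g B)"
    using *(6) pos_D[OF d] by (intro ereal_mult_left_mono) auto
  then have "p (\<phi> G) \<le> ereal (n * c - g (\<phi> J) + g (\<phi> B))"
    using p_D[OF d *(2)] * d by (simp add: g_D algebra_simps)
  ultimately show "(\<phi> A, n * c) \<in> test_bounds"
    unfolding test_bounds_def using * d F_D mem_D by blast
qed

text \<open>

  The third condition will make the functional monotone. The fourth is the instance for \<open>g\<close> of closure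
  under derived bounds, with the values of \<open>g\<close> as lower bounds on \<open>F\<close>; it cannot be obtained from maximality in
  the way the other instances are, because \<open>\<eta>\<close> may lie strictly below \<open>g\<close> on \<open>F\<close>.
\<close>

definition admissible :: "('a \<times> real) set \<Rightarrow> bool" where
  "admissible U \<longleftrightarrow> wedge U \<and> test_bounds \<subseteq> U \<and>
     (\<forall>A A' c. A \<in> S \<longrightarrow> A \<preceq> A' \<longrightarrow> (A', c) \<in> U \<longrightarrow> (A, c) \<in> U) \<and>
     (\<forall>A B c. A \<in> S \<longrightarrow> B \<in> F \<longrightarrow> (A \<oplus> B, c) \<in> U \<longrightarrow> (A, c - g B) \<in> U) \<and>
     (\<forall>A c. (A, c) \<in> U \<longrightarrow> \<eta> A \<le> ereal c)"

lemma admissible_test_bounds: "admissible test_bounds"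
  unfolding admissible_def
proof (intro conjI allI impI wedge_test_bounds subset_refl)
  fix A A' c assume A: "A \<in> S" "A \<preceq> A'" and "(A', c) \<in> test_bounds"
  then obtain G B J where *: "A' \<in> S" "G \<in> S" "B \<in> F" "J \<in> F" "A' \<oplus> B \<preceq> G \<oplus> J"
     "p G \<le> ereal (c - g J + g B)"
    by (auto simp: test_bounds_def)
  then have s: "B \<in> S" "J \<in> S" by (auto dest: F_S)
  have "A \<oplus> B \<preceq> A' \<oplus> B" using * s A by (simp add: le_plus_mono le_refl)
  then have "A \<oplus> B \<preceq> G \<oplus> J" using * s A by (auto intro: le_trans[of _ "A' \<oplus> B"])
  then show "(A, c) \<in> test_bounds" using * A by (auto simp: test_bounds_def)
next
  fix A B c assume A: "A \<in> S" "B \<in> F" and "(A \<oplus> B, c) \<in> test_bounds"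
  then obtain G B' J where *: "G \<in> S" "B' \<in> F" "J \<in> F" "A \<oplus> B \<oplus> B' \<preceq> G \<oplus> J"
     "p G \<le> ereal (c - g J + g B')"
    by (auto simp: test_bounds_def)
  then have "A \<oplus> (B \<oplus> B') \<preceq> G \<oplus> J" using A by (simp add: assoc F_S)
  moreover have "p G \<le> ereal ((c - g B) - g J + g (B \<oplus> B'))" using *(2,5) A by (simp add: g_plus algebra_simps)
  ultimately show "(A, c - g B) \<in> test_bounds"
    unfolding test_bounds_def using A * F_plus by blast
next
  fix A c assume "(A, c) \<in> test_bounds"
  then obtain G B J where *: "A \<in> S" "G \<in> S" "B \<in> F" "J \<in> F" "A \<oplus> B \<preceq> G \<oplus> J"
     "p G \<le> ereal (c - g J + g B)"
    by (auto simp: test_bounds_def)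
  have "\<eta> A \<le> p G + ereal (g J) - ereal (g B)" using * consistent by blast
  also have "\<dots> \<le> ereal c" using *(6) by (cases "p G") auto
  finally show "\<eta> A \<le> ereal c" .
qed

text \<open>

  The step of the extension argument: lower bounds can be adjoined as soon as \<open>\<eta>\<close> respects their
  consequences. As the inclusion of \<open>U\<close> in \<open>derived_bounds U T\<close> is then one of admissible sets, a
  maximal \<open>U\<close> is closed under these consequences.
\<close>

lemma admissible_derived_bounds:
  assumes U: "admissible U" and T: "wedge T"
    and c: "\<And>A c E s. A \<in> S \<Longrightarrow> (E, s) \<in> T \<Longrightarrow> (A \<oplus> E, c + s) \<in> U \<Longrightarrow> \<eta> A \<le> ereal c"
  shows "admissible (derived_bounds U T)"
  unfolding admissible_def
proof (intro conjI allI impI)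
  have u: "wedge U" using U by (auto simp: admissible_def)
  show "wedge (derived_bounds U T)" using wedge_derived_bounds u T by blast
  show "test_bounds \<subseteq> derived_bounds U T" using subset_derived_bounds[OF u T] U by (auto simp: admissible_def)
next
  fix A A' c assume A: "A \<in> S" "A \<preceq> A'" and "(A', c) \<in> derived_bounds U T"
  then obtain E s where e: "(E, s) \<in> T" "(A' \<oplus> E, c + s) \<in> U" "A' \<in> S"
    by (auto simp: derived_bounds_def)
  then have m: "E \<in> S" using T by (auto simp: wedge_def)
  have "A \<oplus> E \<preceq> A' \<oplus> E" using A e m by (simp add: le_plus_mono le_refl)
  then have "(A \<oplus> E, c + s) \<in> U" using U e m A by (auto simp: admissible_def)
  then show "(A, c) \<in> derived_bounds U T" using A e by (auto simp: derived_bounds_def)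
next
  fix A B c assume A: "A \<in> S" "B \<in> F" and "(A \<oplus> B, c) \<in> derived_bounds U T"
  then obtain E s where e: "(E, s) \<in> T" "(A \<oplus> B \<oplus> E, c + s) \<in> U"
    by (auto simp: derived_bounds_def)
  then have m: "E \<in> S" using T by (auto simp: wedge_def)
  have "(A \<oplus> E \<oplus> B, c + s) \<in> U" using e m A F_S by (simp add: right_commute)
  then have "(A \<oplus> E, c + s - g B) \<in> U" using U m A by (auto simp: admissible_def)
  then have "(A \<oplus> E, (c - g B) + s) \<in> U" by (simp add: algebra_simps)
  then show "(A, c - g B) \<in> derived_bounds U T" using A e by (auto simp: derived_bounds_def)
next
  fix A c assume "(A, c) \<in> derived_bounds U T"
  then show "\<eta> A \<le> ereal c" using c by (auto simp: derived_bounds_def)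
qed

lemma maximal_admissible:
  obtains U where "admissible U" "\<And>V. admissible V \<Longrightarrow> U \<subseteq> V \<Longrightarrow> V = U"
proof -
  have "\<exists>M\<in>{U. admissible U}. \<forall>X\<in>{U. admissible U}. M \<subseteq> X \<longrightarrow> X = M"
  proof (rule subset_Zorn_nonempty)
    show "{U. admissible U} \<noteq> {}" using admissible_test_bounds by auto
    fix \<C> assume ne: "\<C> \<noteq> {}" and "subset.chain {U. admissible U} \<C>"
    then have ch: "\<C> \<subseteq> {U. admissible U}" "\<forall>U\<in>\<C>. \<forall>V\<in>\<C>. U \<subset> V \<or> U = V \<or> V \<subset> U"
      by (auto simp: subset.chain_def)
    then have ad: "admissible U" if "U \<in> \<C>" for U using that by auto
    have tot: "U \<subseteq> V \<or> V \<subseteq> U" if "U \<in> \<C>" "V \<in> \<C>" for U V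
      using ch(2) that by blast
    have wd: "wedge U" if "U \<in> \<C>" for U using ad[OF that] by (simp add: admissible_def)
    have "wedge (\<Union>\<C>)"
      unfolding wedge_def
    proof (intro conjI allI impI)
      show "\<Union>\<C> \<subseteq> S \<times> UNIV" using wd by (fastforce simp: wedge_def)
      show "(\<zero>, 0) \<in> \<Union>\<C>" using wd ne by (auto simp: wedge_def)
    next
      fix A c B d assume "(A, c) \<in> \<Union>\<C>" "(B, d) \<in> \<Union>\<C>"
      then obtain U where "U \<in> \<C>" "(A, c) \<in> U" "(B, d) \<in> U" using tot by blast
      then show "(A \<oplus> B, c + d) \<in> \<Union>\<C>" using wd[of U] unfolding wedge_def by blast
    next
      fix n \<phi> A c assume "(n, \<phi>) \<in> D" "(A, c) \<in> \<Union>\<C>"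
      then show "(\<phi> A, n * c) \<in> \<Union>\<C>" using wd by (fastforce simp: wedge_def)
    qed
    then show "\<Union>\<C> \<in> {U. admissible U}"
      using ad ne unfolding admissible_def mem_Collect_eq
      by (intro conjI) (blast+)
  qed
  then show thesis using that by blast
qed

text \<open>

  The best upper bound for a value at \<open>A\<close> that homogeneity can extract from \<open>U\<close>: a bound \<open>n * c\<close> for a sum of
  dilates of \<open>A\<close> of total weight \<open>n\<close> bounds the value at \<open>A\<close> by \<open>c\<close>.
\<close>

definition envelope :: "('a \<times> real) set \<Rightarrow> 'a \<Rightarrow> ereal" where
  "envelope U A = Inf {ereal c | c n \<phi>. (n, \<phi>) \<in> W \<and> (\<phi> A, n * c) \<in> U}"

lemma envelope_le: "(n, \<phi>) \<in> W \<Longrightarrow> (\<phi> A, n * c) \<in> U \<Longrightarrow> envelope U A \<le> ereal c"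
  unfolding envelope_def by (rule Inf_lower) blast

lemma envelope_le_1: "(A, c) \<in> U \<Longrightarrow> envelope U A \<le> ereal c"
  using envelope_le[OF W.base[OF unit_D]] by simp

lemma le_envelope:
  "(\<And>n \<phi> c. (n, \<phi>) \<in> W \<Longrightarrow> (\<phi> A, n * c) \<in> U \<Longrightarrow> x \<le> ereal c) \<Longrightarrow> x \<le> envelope U A"
  unfolding envelope_def by (rule Inf_greatest) blast

lemma envelope_plus_le:
  assumes U: "wedge U" and A: "A \<in> S" "B \<in> S"
    and f: "envelope U A \<noteq> -\<infinity>" "envelope U B \<noteq> -\<infinity>"
  shows "envelope U (A \<oplus> B) \<le> envelope U A + envelope U B"
proof -
  have *: "envelope U (A \<oplus> B) \<le> ereal c + ereal d"
    if "(n, \<phi>) \<in> W" "(\<phi> A, n * c) \<in> U" "(m, \<psi>) \<in> W" "(\<psi> B, m * d) \<in> U" for n \<phi> c m \<psi> d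
  proof -
    have "(\<psi> (\<phi> A), m * (n * c)) \<in> U" "(\<phi> (\<psi> B), n * (m * d)) \<in> U"
      using that U by (blast intro: wedge_W)+
    then have "(\<psi> (\<phi> A) \<oplus> \<phi> (\<psi> B), m * (n * c) + n * (m * d)) \<in> U"
      using U by (simp add: wedge_def)
    then have "(\<phi> (\<psi> (A \<oplus> B)), (n * m) * (c + d)) \<in> U"
      using that A commute_W[OF that(3) that(1)]
      by (simp add: plus_W mem_W algebra_simps)
    then show ?thesis using envelope_le[OF W.comp[OF that(1,3)]] by simp
  qed
  have 1: "envelope U (A \<oplus> B) - ereal d \<le> envelope U A"
    if "(m, \<psi>) \<in> W" "(\<psi> B, m * d) \<in> U" for m \<psi> d
    using *[OF _ _ that] by (intro le_envelope) (simp add: ereal_minus_le)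
  show ?thesis
  proof (cases "envelope U A")
    case (real a)
    have "envelope U (A \<oplus> B) - ereal a \<le> envelope U B"
      using 1 real by (intro le_envelope) (fastforce simp: ereal_minus_le algebra_simps)
    then show ?thesis using real by (simp add: ereal_minus_le add.commute)
  qed (use f in auto)
qed

lemma envelope_D:
  assumes U: "wedge U" and A: "A \<in> S" and d: "(n, \<phi>) \<in> D"
  shows "envelope U (\<phi> A) = ereal n * envelope U A"
proof -
  note w = W.base[OF d]
  have n: "n > 0" using d pos_D by blast
  have "envelope U (\<phi> A) / ereal n \<le> envelope U A"
  proof (rule le_envelope)
    fix m \<psi> c assume h: "(m, \<psi>) \<in> W" "(\<psi> A, m * c) \<in> U"
    have "(\<phi> (\<psi> A), n * (m * c)) \<in> U" using wedge_W[OF w U h(2)] .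
    then have "(\<psi> (\<phi> A), m * (n * c)) \<in> U" using commute_W[OF w h(1) A] by (simp add: ac_simps)
    from envelope_le[OF h(1) this] show "envelope U (\<phi> A) / ereal n \<le> ereal c"
      using n by (simp add: ereal_divide_le_pos)
  qed
  then have 1: "envelope U (\<phi> A) \<le> ereal n * envelope U A"
    using n by (simp add: ereal_divide_le_pos)
  have "ereal n * envelope U A \<le> envelope U (\<phi> A)"
  proof (rule le_envelope)
    fix m \<psi> c assume h: "(m, \<psi>) \<in> W" "(\<psi> (\<phi> A), m * c) \<in> U"
    have "envelope U A \<le> ereal (c / n)"
      using envelope_le[OF W.comp[OF h(1) w]] h(2) n by simp
    then show "ereal n * envelope U A \<le> ereal c"
      using n ereal_mult_left_mono[of "envelope U A" "ereal (c / n)" "ereal n"] by simp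
  qed
  with 1 show ?thesis by simp
qed

text \<open>

  The functional is the envelope of a maximal admissible set. Values \<open>\<infinity>\<close> are allowed for \<open>h\<close>, and they cause no
  trouble: the lower bounds given by \<open>\<eta> > -\<infinity>\<close> turn an upper bound for \<open>A + B\<close> into one for \<open>B\<close>, so an
  infinite envelope at \<open>B\<close> makes the one at \<open>A + B\<close> infinite as well.
\<close>

theorem additive_between:
  obtains h where "\<And>A. A \<in> S \<Longrightarrow> h A \<noteq> -\<infinity>"
    "\<And>A B. A \<in> S \<Longrightarrow> B \<in> S \<Longrightarrow> h (A \<oplus> B) = h A + h B"
    "\<And>n \<phi> A. (n, \<phi>) \<in> D \<Longrightarrow> A \<in> S \<Longrightarrow> h (\<phi> A) = ereal n * h A"
    "\<And>A B. A \<in> S \<Longrightarrow> B \<in> S \<Longrightarrow> A \<preceq> B \<Longrightarrow> h A \<le> h B"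
    "\<And>A. A \<in> F \<Longrightarrow> h A = ereal (g A)"
    "\<And>A. A \<in> S \<Longrightarrow> \<eta> A \<le> h A"
    "\<And>A. A \<in> S \<Longrightarrow> h A \<le> p A"
proof -
  obtain U where ad: "admissible U" and max: "\<And>V. admissible V \<Longrightarrow> U \<subseteq> V \<Longrightarrow> V = U"
    using maximal_admissible by blast
  have U: "wedge U" and tb: "test_bounds \<subseteq> U"
    and down: "\<And>A A' c. A \<in> S \<Longrightarrow> A \<preceq> A' \<Longrightarrow> (A', c) \<in> U \<Longrightarrow> (A, c) \<in> U"
    and gsh: "\<And>A B c. A \<in> S \<Longrightarrow> B \<in> F \<Longrightarrow> (A \<oplus> B, c) \<in> U \<Longrightarrow> (A, c - g B) \<in> U"
    and lower: "\<And>A c. (A, c) \<in> U \<Longrightarrow> \<eta> A \<le> ereal c"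
    using ad unfolding admissible_def by blast+
  let ?h = "envelope U"
  have absorb: "(A, c) \<in> U" if "wedge T"
    and "\<And>A c E s. A \<in> S \<Longrightarrow> (E, s) \<in> T \<Longrightarrow> (A \<oplus> E, c + s) \<in> U \<Longrightarrow> \<eta> A \<le> ereal c"
    and "A \<in> S" "(E, s) \<in> T" "(A \<oplus> E, c + s) \<in> U" for T A c E s
  proof -
    have "derived_bounds U T = U"
      using that(2) by (intro max admissible_derived_bounds ad that(1) subset_derived_bounds U)
    then show ?thesis using that(3-5) by (auto simp: derived_bounds_def)
  qed

  have T\<eta>: "wedge {(E, s). E \<in> S \<and> ereal s \<le> \<eta> E}" (is "wedge ?T")
    unfolding wedge_def
  proof (intro conjI allI impI)
    fix A c B d assume "(A, c) \<in> ?T" "(B, d) \<in> ?T"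
    then have *: "A \<in> S" "B \<in> S" "ereal c \<le> \<eta> A" "ereal d \<le> \<eta> B" by auto
    then have "ereal c + ereal d \<le> \<eta> A + \<eta> B" by (intro add_mono)
    also have "\<dots> \<le> \<eta> (A \<oplus> B)" using * \<eta>_plus by simp
    finally show "(A \<oplus> B, c + d) \<in> ?T" using * by simp
  next
    fix n \<phi> A c assume d: "(n, \<phi>) \<in> D" and "(A, c) \<in> ?T"
    then have *: "A \<in> S" "ereal c \<le> \<eta> A" by auto
    then have "ereal n * ereal c \<le> ereal n * \<eta> A"
      using pos_D[OF d] by (intro ereal_mult_left_mono) auto
    also have "\<dots> \<le> \<eta> (\<phi> A)" using * d \<eta>_D by simp
    finally show "(\<phi> A, n * c) \<in> ?T" using * d by (simp add: mem_D)
  qed (auto simp: \<eta>_zero)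
  have \<eta>_absorb: "(A, c) \<in> U" if "A \<in> S" "E \<in> S" "ereal s \<le> \<eta> E" "(A \<oplus> E, c + s) \<in> U" for A c E s
  proof (rule absorb[OF T\<eta> _ that(1) _ that(4)])
    fix A c E s assume "A \<in> S" "(E, s) \<in> ?T" "(A \<oplus> E, c + s) \<in> U"
    then have *: "A \<in> S" "E \<in> S" "ereal s \<le> \<eta> E" "\<eta> (A \<oplus> E) \<le> ereal (c + s)"
      using lower by auto
    have "\<eta> A + ereal s \<le> \<eta> A + \<eta> E" using * by (intro add_mono) auto
    also have "\<dots> \<le> ereal (c + s)" using * \<eta>_plus[of A E] by simp
    finally show "\<eta> A \<le> ereal c" by (cases "\<eta> A") auto
  qed (use that in auto)
  have \<eta>_W: "ereal (n * s) \<le> \<eta> (\<phi> A)" if "(n, \<phi>) \<in> W" "A \<in> S" "ereal s \<le> \<eta> A" for n \<phi> A s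
    using wedge_W[OF that(1) T\<eta>, of A s] that by auto
  \<comment> \<open>Bounds in \<open>U\<close> are real while \<open>\<eta>\<close> may be infinite, so \<open>\<eta>\<close> is tested through its real minorants.\<close>
  have sep: "x \<le> y" if "\<And>s. ereal s \<le> x \<Longrightarrow> ereal s \<le> y" for x y :: ereal
  proof (cases x)
    case (real r)
    then show ?thesis using that[of r] by simp
  next
    case PInf
    then show ?thesis using that ereal_top[of y] by simp
  qed simp

  have \<eta>_le: "\<eta> A \<le> ?h A" if "A \<in> S" for A
  proof (rule le_envelope)
    fix n \<phi> c assume h: "(n, \<phi>) \<in> W" "(\<phi> A, n * c) \<in> U"
    show "\<eta> A \<le> ereal c"
    proof (rule sep)
      fix s assume "ereal s \<le> \<eta> A"
      from \<eta>_W[OF h(1) that this] lower[OF h(2)] have "ereal (n * s) \<le> ereal (n * c)"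
        by (rule order_trans)
      then show "ereal s \<le> ereal c" using pos_W[OF h(1)] by simp
    qed
  qed
  have above: "?h A \<noteq> -\<infinity>" if "A \<in> S" for A
    using \<eta>_le[OF that] \<eta>_above[OF that] by auto
  \<comment> \<open>An element \<open>\<phi> B\<close> may be cancelled at the price of its best upper bound \<open>n * t\<close>. That \<open>\<eta>\<close> is
    consistent with this holds because moving \<open>A\<close> to the other side, by \<open>\<eta>_absorb\<close>, leaves an upper
    bound for \<open>\<phi> B\<close>, which cannot be better than \<open>n * t\<close>.\<close>
  have finite_absorb: "(A, c - n * t) \<in> U"
    if "A \<in> S" "B \<in> S" "?h B = ereal t" "(n, \<phi>) \<in> W" "(A \<oplus> \<phi> B, c) \<in> U" for A B c n t \<phi>
  proof (rule absorb[where E = "\<phi> B" and s = "n * t"])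
    let ?T = "insert (\<zero>, 0) {(\<phi> B, n * t) | n \<phi>. (n, \<phi>) \<in> W}"
    show "wedge ?T"
      unfolding wedge_def
    proof (intro conjI allI impI)
      fix A c A' d assume h: "(A, c) \<in> ?T" "(A', d) \<in> ?T"
      have m: "\<phi> B \<in> S" if "(n, \<phi>) \<in> W" for n \<phi> using that \<open>B \<in> S\<close> by (rule mem_W)
      have z: "\<zero> \<oplus> \<phi> B = \<phi> B" if "(n, \<phi>) \<in> W" for n \<phi>
        using commute[of \<zero> "\<phi> B"] m[OF that] by simp
      show "(A \<oplus> A', c + d) \<in> ?T" using h
        by (auto simp: m z distrib_right[symmetric]) (use W.sum in fast)+
    next
      fix n \<phi> A c assume "(n, \<phi>) \<in> D" "(A, c) \<in> ?T"
      then show "(\<phi> A, n * c) \<in> ?T" using W.base W.comp zero_D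
        by (fastforce simp: mult.assoc[symmetric])
    qed (use \<open>B \<in> S\<close> in \<open>auto simp: mem_W\<close>)
    fix A c E s assume A: "A \<in> S" "(E, s) \<in> ?T" "(A \<oplus> E, c + s) \<in> U"
    show "\<eta> A \<le> ereal c"
    proof (cases "(E, s) = (\<zero>, 0)")
      case True
      then show ?thesis using A lower by simp
    next
      case False
      then obtain n \<phi> where w: "(n, \<phi>) \<in> W" "E = \<phi> B" "s = n * t" using A by auto
      have E: "E \<in> S" using w \<open>B \<in> S\<close> mem_W by simp
      show ?thesis
      proof (rule sep)
        fix r assume r: "ereal r \<le> \<eta> A"
        have "(E \<oplus> A, (c + s - r) + r) \<in> U" using A E by (simp add: commute)
        from \<eta>_absorb[OF E A(1) r this] have "(\<phi> B, n * ((c + s - r) / n)) \<in> U"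
          using w pos_W[of n \<phi>] by simp
        from envelope_le[OF w(1) this] have "t \<le> (c + s - r) / n" using \<open>?h B = ereal t\<close> by simp
        then show "ereal r \<le> ereal c" using w pos_W[of n \<phi>] by (simp add: field_simps)
      qed
    qed
  qed (use that in auto)
  have plus_ge: "?h A + ?h B \<le> ?h (A \<oplus> B)" if A: "A \<in> S" "B \<in> S" for A B
  proof (rule le_envelope)
    fix n \<phi> c assume h: "(n, \<phi>) \<in> W" "(\<phi> (A \<oplus> B), n * c) \<in> U"
    have n: "n > 0" using h(1) by (rule pos_W)
    have h': "(\<phi> A \<oplus> \<phi> B, n * c) \<in> U" "(\<phi> B \<oplus> \<phi> A, n * c) \<in> U" "\<phi> A \<in> S" "\<phi> B \<in> S"
      using h A by (auto simp: plus_W mem_W commute)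
    have fin: "?h B \<noteq> \<infinity>"
    proof -
      obtain s where "ereal s \<le> \<eta> A" using \<eta>_above[OF A(1)] by (cases "\<eta> A") auto
      then have "ereal (n * s) \<le> \<eta> (\<phi> A)" using \<eta>_W h A by simp
      then have "(\<phi> B, n * (c - s)) \<in> U"
        using \<eta>_absorb[of "\<phi> B" "\<phi> A" "n * s" "n * (c - s)"] h' by (simp add: algebra_simps)
      then have "?h B \<le> ereal (c - s)" using envelope_le h by blast
      then show ?thesis by auto
    qed
    then obtain t where t: "?h B = ereal t" using above[OF A(2)] by (cases "?h B") auto
    have "(\<phi> A, n * (c - t)) \<in> U"
      using finite_absorb[OF h'(3) A(2) t h(1) h'(1)] by (simp add: algebra_simps)
    then have "?h A \<le> ereal (c - t)" using envelope_le h by blast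
    then show "?h A + ?h B \<le> ereal c" using t by (cases "?h A") auto
  qed
  have le_p: "?h A \<le> p A" if "A \<in> S" for A
  proof (cases "p A = \<infinity>")
    case False
    have "?h A \<le> ereal c" if "p A \<le> ereal c" for c
    proof (rule envelope_le_1)
      have "A \<oplus> \<zero> \<preceq> A \<oplus> \<zero>" "p A \<le> ereal (c - g \<zero> + g \<zero>)"
        using that \<open>A \<in> S\<close> by (simp_all add: le_refl)
      then have "(A, c) \<in> test_bounds"
        unfolding test_bounds_def using \<open>A \<in> S\<close> F_zero by blast
      then show "(A, c) \<in> U" using tb by auto
    qed
    then show ?thesis by (rule ereal_le_real)
  qed simp
  have eq_g: "?h B = ereal (g B)" if B: "B \<in> F" for B
  proof (rule antisym)
    have zB: "\<zero> \<oplus> B = B" using commute[of \<zero> B] B F_S by simp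
    have "B \<oplus> \<zero> \<preceq> \<zero> \<oplus> B" "p \<zero> \<le> ereal (g B - g B + g \<zero>)"
      using B F_S zB g_zero p_zero by (simp_all add: le_refl)
    then have "(B, g B) \<in> test_bounds"
      unfolding test_bounds_def using B F_S F_zero zero_mem by blast
    then show "?h B \<le> ereal (g B)" using tb by (auto intro: envelope_le_1)
    have "wedge ((\<lambda>B. (B, g B)) ` F)"
      unfolding wedge_def using F_S F_zero g_zero F_plus g_plus F_D g_D by (auto simp: image_iff)
    then have W: "\<phi> B \<in> F \<and> g (\<phi> B) = n * g B" if "(n, \<phi>) \<in> W" for n \<phi>
      using wedge_W[OF that, of "(\<lambda>B. (B, g B)) ` F" B "g B"] B by auto
    show "ereal (g B) \<le> ?h B"
    proof (rule le_envelope)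
      fix n \<phi> c assume h: "(n, \<phi>) \<in> W" "(\<phi> B, n * c) \<in> U"
      have "\<zero> \<oplus> \<phi> B = \<phi> B" using commute[of \<zero> "\<phi> B"] W[OF h(1)] F_S by simp
      then have "(\<zero>, n * c - g (\<phi> B)) \<in> U" using W[OF h(1)] h(2) gsh[of \<zero> "\<phi> B" "n * c"] by simp
      from lower[OF this] have "0 \<le> n * (c - g B)"
        using W[OF h(1)] \<eta>_zero by (simp add: algebra_simps)
      then show "ereal (g B) \<le> ereal c" using pos_W[OF h(1)] by (simp add: zero_le_mult_iff)
    qed
  qed
  show thesis
  proof (rule that[of ?h])
    show "?h (A \<oplus> B) = ?h A + ?h B" if "A \<in> S" "B \<in> S" for A B
      using plus_ge[OF that] envelope_plus_le[OF U that above above] that by (simp add: antisym)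
    show "?h A \<le> ?h B" if "A \<in> S" "B \<in> S" "A \<preceq> B" for A B
      using that by (intro le_envelope) (meson down envelope_le mono_W mem_W)
  qed (use above eq_g \<eta>_le le_p envelope_D[OF U] in auto)
qed

end

section \<open>Reduction of maps on pairs to the origin\<close>

lemma lower_add_le: "lower_add a b \<le> a + b"
  by (cases a; cases b) (auto simp: lower_add_def)

lemma lower_add_eq: "a \<noteq> -\<infinity> \<Longrightarrow> b \<noteq> -\<infinity> \<Longrightarrow> lower_add a b = a + b"
  by (cases a; cases b) (auto simp: lower_add_def)

lemma semilinear_imp_superlinear:
  assumes "semilinear emb scl splus X S h" shows "superlinear emb scl splus X S h"
  using assms lower_add_le unfolding semilinear_def superlinear_def real_linear_def by simp

locale hahn_banach_problem =
  vector_space scl +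
  S: quasisemilinear_preordered_space scl P splus le UNIV S +
  F: quasisemilinear_preordered_space scl P splus le H F
  for emb :: "'k::field \<Rightarrow> complex" and scl :: "'k \<Rightarrow> 'x::ab_group_add \<Rightarrow> 'x"
    and P splus le S H F +
  fixes p g :: "'x \<Rightarrow> 'x set \<Rightarrow> ereal"
  assumes embedding: "scalar_embedding emb"
    and P: "P = UNIV - {0} \<or> P = pos_scalars emb"
    and H: "subspace H"
    and F_S: "F \<subseteq> S"
    and p: "sublinear emb scl splus UNIV S p"
    and g_fin: "finite_map H F g"
    and g: "semilinear emb scl splus H F g"
begin

abbreviation re :: "'k \<Rightarrow> real" where "re a \<equiv> Re (emb a)"

lemma emb_simps: "emb 1 = 1" "emb (a + b) = emb a + emb b" "emb (a * b) = emb a * emb b"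
    "emb 0 = 0" "emb (- a) = - emb a"
proof -
  show *: "emb 1 = 1" "emb (a + b) = emb a + emb b" "emb (a * b) = emb a * emb b" for a b
    using embedding by (auto simp: scalar_embedding_def)
  show z: "emb 0 = 0" using *(2)[of 0 0] by simp
  show "emb (- a) = - emb a" using *(2)[of a "-a"] z by (simp add: eq_neg_iff_add_eq_0 add.commute)
qed

lemma emb_eq_0: "emb a = 0 \<longleftrightarrow> a = 0"
  using emb_simps(1) emb_simps(3)[of a "inverse a"] emb_simps(4) by (cases "a = 0") auto

lemma emb_of_nat: "emb (of_nat n) = of_nat n"
  by (induction n) (simp_all add: emb_simps)

lemma pos_scalars_P: "a \<in> pos_scalars emb \<Longrightarrow> a \<in> P"
  using P emb_simps(4) by (auto simp: pos_scalars_def)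

lemma one_pos: "1 \<in> pos_scalars emb"
  by (simp add: pos_scalars_def emb_simps)

lemma re_pos: "a \<in> pos_scalars emb \<Longrightarrow> 0 < re a"
  by (simp add: pos_scalars_def)

lemma image_scl_one [simp]: "scl 1 ` A = A"
  by simp

lemma mem_F: "A \<in> F \<Longrightarrow> A \<in> S"
  using F_S by auto

lemma zero_H: "0 \<in> H" and uminus_H: "x \<in> H \<Longrightarrow> - x \<in> H"
  using H subspace_0 subspace_neg by blast+

lemma translate_empty: "translate v {} = {v}"
  by (simp add: translate_def)

lemma singleton_S: "{v} \<in> S"
  using S.translate_closed[OF _ S.empty_mem, of v] by (simp add: translate_empty)

lemma translate_zero: "A \<noteq> {} \<Longrightarrow> translate 0 A = A"
  by (simp add: translate_def)

lemma translate_translate: "translate v (translate w A) = translate (v + w) A"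
  by (auto simp: translate_def image_image add.assoc)

lemma translate_splus:
  assumes "A \<in> S" "B \<in> S"
  shows "translate v (splus A B) = splus (translate v A) B"
  using assms by (simp add: S.translate_plus S.plus_closed S.plus_assoc singleton_S)

lemma splus_interchange:
  assumes "A \<in> S" "B \<in> S" "C \<in> S" "E \<in> S"
  shows "splus (splus A B) (splus C E) = splus (splus A C) (splus B E)"
  using assms by (smt (verit) S.plus_assoc S.plus_commute S.plus_closed)

lemma invariant_at_0:
  assumes "invariant_homogeneous emb scl X T f" "x \<in> X" "- x \<in> X" "A \<in> T"
  shows "f x A = f 0 (translate (- x) A)"
proof -
  have "f (- x + x) (translate (- x) A) = f x A"
    using assms unfolding invariant_homogeneous_def by blast
  then show ?thesis by simp
qed

text \<open>

  Since \<open>f(x, {}) = f(0, {-x})\<close>, a semilinear map is the sum of a real linear functional of the position and an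
  additive functional of the set.
\<close>

lemma split_position:
  assumes f: "semilinear emb scl splus X T f" and T: "T \<subseteq> S"
    and tr: "\<And>v A. v \<in> X \<Longrightarrow> A \<in> T \<Longrightarrow> translate v A \<in> T" and e: "{} \<in> T"
    and x: "x \<in> X" "- x \<in> X" "A \<in> T"
  shows "f x A = f x {} + f 0 A"
proof -
  have s: "{- x} \<in> T" using tr[OF x(2) e] by (simp add: translate_empty)
  have i: "invariant_homogeneous emb scl X T f" using f by (simp add: semilinear_def)
  have "f x A = f 0 (splus {- x} A)"
    using invariant_at_0[OF i x] S.translate_plus[of "- x" A] x(3) T by auto
  also have "\<dots> = f 0 {- x} + f 0 A" using f s x by (simp add: semilinear_def)
  also have "f 0 {- x} = f x {}" using invariant_at_0[OF i x(1,2) e] by (simp add: translate_empty)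
  finally show ?thesis .
qed

lemma multiple_value:
  assumes h0: "h {} = (0::ereal)" and plus: "\<And>A B. A \<in> S \<Longrightarrow> B \<in> S \<Longrightarrow> h (splus A B) = h A + h B"
    and A: "A \<in> S"
  shows "multiple splus n A \<in> S \<and> h (multiple splus n A) = ereal (real n) * h A"
proof (induction n)
  case 0
  then show ?case using h0 S.empty_mem by (simp add: multiple_def zero_ereal_def[symmetric])
next
  case (Suc n)
  have "ereal (real (Suc n)) * h A = h A + ereal (real n) * h A"
    using ereal_left_distrib[of 1 "ereal (real n)" "h A"] by (simp add: one_ereal_def)
  then show ?case using Suc A plus by (simp add: multiple_def S.plus_closed)
qed

text \<open>

  Only additivity and homogeneity matter, so this applies to \<open>h(0, \<cdot>)\<close> with infinite values too:
  \<open>n\<^sub>1 a\<^sub>1 h(A) + \<dots> + n\<^sub>k a\<^sub>k h(A)\<close> is a sum with nonnegative coefficients, where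
  distributivity still holds. For the empty list, \<open>0 * \<infinity> = 0\<close> gives the value at \<open>{}\<close>.
\<close>

lemma weighted_sum_value:
  assumes h0: "h {} = (0::ereal)" and plus: "\<And>A B. A \<in> S \<Longrightarrow> B \<in> S \<Longrightarrow> h (splus A B) = h A + h B"
    and scl: "\<And>a A. a \<in> pos_scalars emb \<Longrightarrow> A \<in> S \<Longrightarrow> h (scl a ` A) = scalar_val emb a * h A"
    and A: "A \<in> S" and ts: "\<forall>(n, a)\<in>set ts. 0 < n \<and> a \<in> pos_scalars emb"
  shows "weighted_sum scl splus ts A \<in> S \<and>
         h (weighted_sum scl splus ts A) = scalar_val emb (total_weight ts) * h A \<and>
         emb (total_weight ts) \<in> \<real> \<and> 0 \<le> re (total_weight ts)"
  using ts
proof (induction ts)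
  case Nil
  then show ?case using h0 S.empty_mem
    by (simp add: weighted_sum_def total_weight_def emb_simps zero_ereal_def[symmetric])
next
  case (Cons na ts)
  obtain n a where na: "na = (n, a)" by fastforce
  have a: "a \<in> pos_scalars emb" using Cons.prems na by auto
  then have aA: "scl a ` A \<in> S" using S.scale_closed[OF pos_scalars_P A] by simp
  note m = multiple_value[OF h0 plus aA, of n]
  have w: "weighted_sum scl splus (na # ts) A
      = splus (multiple splus n (scl a ` A)) (weighted_sum scl splus ts A)"
    by (simp add: weighted_sum_def na)
  have t: "emb (total_weight (na # ts)) = of_nat n * emb a + emb (total_weight ts)"
    by (simp add: total_weight_def na emb_simps emb_of_nat)
  have IH: "weighted_sum scl splus ts A \<in> S"
    "h (weighted_sum scl splus ts A) = scalar_val emb (total_weight ts) * h A"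
    "emb (total_weight ts) \<in> \<real>" "0 \<le> re (total_weight ts)"
    using Cons by auto
  have "h (weighted_sum scl splus (na # ts) A)
      = ereal (real n) * (scalar_val emb a * h A) + scalar_val emb (total_weight ts) * h A"
    using w m IH plus scl[OF a A] by simp
  also have "\<dots> = (ereal (real n * re a) + scalar_val emb (total_weight ts)) * h A"
    using IH(4) re_pos[OF a] by (subst ereal_left_distrib) (auto simp: mult.assoc[symmetric])
  finally show ?case
    using w m IH S.plus_closed t a re_pos[OF a] by (auto simp: pos_scalars_def)
qed

lemma total_weight_pos:
  assumes "ts \<noteq> []" "\<forall>(n, a)\<in>set ts. 0 < n \<and> a \<in> pos_scalars emb"
  shows "0 < re (total_weight ts)"
  using assms
proof (induction ts)
  case (Cons na ts)
  obtain n a where na: "na = (n, a)" by fastforce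
  have "0 < real n * re a" using Cons.prems na by (auto simp: re_pos)
  moreover have "re (total_weight (na # ts)) = real n * re a + re (total_weight ts)"
    by (simp add: total_weight_def na emb_simps emb_of_nat)
  moreover have "0 \<le> re (total_weight ts)"
    using Cons by (cases "ts = []") (auto simp: total_weight_def emb_simps intro: less_imp_le)
  ultimately show ?case by simp
qed simp

text \<open>

  Applying \<open>h\<close> to a test relation gives the bound. The positions contribute an identity between real numbers,
  so the set parts can be treated alone; they require that \<open>C\<close> can be cancelled under \<open>h\<close>, which is
  the hypothesis \<open>mono\<close>. In the arithmetic only \<open>h(0, A)\<close>, \<open>h(0, G)\<close> and \<open>p(m, G)\<close> can be infinite.
\<close>

lemma extension_le_test_value:
  assumes h: "monotone_HB_extension emb scl splus le S H F p g h"
    and mono: "\<And>A B. A \<in> S \<Longrightarrow> B \<in> S \<Longrightarrow> le (splus A C) (splus B C) \<Longrightarrow> h 0 A \<le> h 0 B"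
    and A: "A \<in> S"
    and t: "test_relation emb scl splus le S H F x A y l m B J G C ts"
  shows "h x A \<le> test_value emb p g y l m B J G ts"
proof -
  have hS: "semilinear emb scl splus UNIV S h" and ext: "\<And>x A. x \<in> H \<Longrightarrow> A \<in> F \<Longrightarrow> h x A = g x A"
    and nm: "\<And>x A. A \<in> S \<Longrightarrow> h x A \<noteq> -\<infinity>" and hp: "\<And>x A. A \<in> S \<Longrightarrow> h x A \<le> p x A"
    using h by (auto simp: monotone_HB_extension_def above_minus_infinity_def dominated_def)
  have yl: "y \<in> H" "l \<in> H" and BJ: "B \<in> F" "J \<in> F" and G: "G \<in> S"
    and ts: "ts \<noteq> []" "\<forall>(n, a)\<in>set ts. 0 < n \<and> a \<in> pos_scalars emb"
    and x: "y + scl (total_weight ts) x = l + m"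
    and le: "le (splus (splus B (weighted_sum scl splus ts A)) C) (splus (splus J G) C)"
    using t by (auto simp: test_relation_def)
  have h0: "h 0 {} = 0" and plus: "\<And>A B. A \<in> S \<Longrightarrow> B \<in> S \<Longrightarrow> h 0 (splus A B) = h 0 A + h 0 B"
    and hscl: "\<And>a A. a \<in> pos_scalars emb \<Longrightarrow> A \<in> S \<Longrightarrow> h 0 (scl a ` A) = scalar_val emb a * h 0 A"
    and lin: "real_linear emb scl UNIV (\<lambda>x. h x {})"
    using hS by (auto simp: semilinear_def invariant_homogeneous_def)
  define n where "n = re (total_weight ts)"
  note ws = weighted_sum_value[of "h 0", OF h0 plus hscl A ts(2), folded n_def]
  have n: "0 < n" unfolding n_def using total_weight_pos[OF ts] .
  have split: "h x A = h x {} + h 0 A" if "A \<in> S" for x A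
    by (rule split_position[OF hS subset_refl S.translate_closed S.empty_mem UNIV_I UNIV_I that])
  have fin: "\<bar>h x {}\<bar> \<noteq> \<infinity>" for x using lin by (simp add: real_linear_def)
  define \<mu> where "\<mu> x = real_of_ereal (h x {})" for x
  have \<mu>: "h x {} = ereal (\<mu> x)" for x using fin[of x] by (simp add: \<mu>_def ereal_real)
  have l_plus: "\<mu> (x + y) = \<mu> x + \<mu> y" for x y
    using lin \<mu> unfolding real_linear_def by (metis UNIV_I plus_ereal.simps(1) ereal.inject)
  have l_scl: "\<mu> (scl (total_weight ts) x) = n * \<mu> x"
    using lin \<mu> ws unfolding real_linear_def n_def by (metis UNIV_I times_ereal.simps(1) ereal.inject)
  have eq: "\<mu> y + n * \<mu> x = \<mu> l + \<mu> m" using x l_plus l_scl by metis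
  have gfin: "\<bar>g x A\<bar> \<noteq> \<infinity>" if "x \<in> H" "A \<in> F" for x A using g_fin that by (simp add: finite_map_def)
  obtain b j where b: "h 0 B = ereal b" and j: "h 0 J = ereal j"
    using gfin[OF zero_H BJ(1)] gfin[OF zero_H BJ(2)] ext[OF zero_H BJ(1)] ext[OF zero_H BJ(2)]
    by (metis ereal_real)
  have gy: "g y B = ereal (\<mu> y + b)" and gl: "g l J = ereal (\<mu> l + j)"
    using split[of B y] split[of J l] ext[OF yl(1) BJ(1)] ext[OF yl(2) BJ(2)] \<mu> b j BJ mem_F by auto
  have "h 0 (splus B (weighted_sum scl splus ts A)) \<le> h 0 (splus J G)"
    using mono[OF _ _ le] ws BJ G mem_F S.plus_closed by simp
  then have main: "ereal b + ereal n * h 0 A \<le> ereal j + h 0 G"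
    using ws BJ G mem_F plus b j by simp
  have pm: "ereal (\<mu> m) + h 0 G \<le> p m G" using hp[OF G, of m] split[OF G, of m] \<mu> by simp
  have "h x A * ereal n \<le> p m G + g l J - g y B"
  proof (cases "p m G")
    case (real q)
    then obtain r where r: "h 0 G = ereal r" using pm nm[OF G, of 0] by (cases "h 0 G") auto
    then obtain a where a: "h 0 A = ereal a" using main n nm[OF A, of 0] by (cases "h 0 A") auto
    have "b + n * a \<le> j + r" "\<mu> m + r \<le> q" using main pm a r real by auto
    moreover have "n * \<mu> x = \<mu> l + \<mu> m - \<mu> y" using eq by simp
    ultimately have "(\<mu> x + a) * n \<le> q + (\<mu> l + j) - (\<mu> y + b)" by (simp add: algebra_simps)
    then show ?thesis using a real gy gl split[OF A, of x] \<mu> by simp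
  next
    case MInf
    then show ?thesis using pm nm[OF G, of 0] by (cases "h 0 G") auto
  qed (simp add: gy gl)
  then show ?thesis using n by (simp add: test_value_def n_def[symmetric] ereal_le_divide_pos mult.commute)
qed

lemma xi_le_test_value_at_0:
  assumes A: "A \<in> S" and B: "B \<in> F" and G: "G \<in> S" and J: "J \<in> F" and C: "C \<in> S"
    and le: "le (splus (splus A B) C) (splus (splus G J) C)"
  shows "xi emb scl splus le S H F p g 0 A \<le> p 0 G + g 0 J - g 0 B"
    and "C = {} \<Longrightarrow> xi0 emb scl splus le S H F p g 0 A \<le> p 0 G + g 0 J - g 0 B"
proof -
  let ?ts = "[(1::nat, 1::'k)]"
  have w: "weighted_sum scl splus ?ts A = A"
    using A by (simp add: weighted_sum_def multiple_def S.plus_empty)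
  have t: "test_relation emb scl splus le S H F 0 A 0 0 0 B J G C ?ts"
    using assms w one_pos zero_H by (simp add: test_relation_def S.plus_commute mem_F)
  have v: "test_value emb p g 0 0 0 B J G ?ts = p 0 G + g 0 J - g 0 B"
    by (simp add: test_value_def total_weight_def emb_simps one_ereal_def[symmetric])
  show "xi emb scl splus le S H F p g 0 A \<le> p 0 G + g 0 J - g 0 B"
    unfolding xi_def v[symmetric] by (rule Inf_lower) (use t in blast)
  show "xi0 emb scl splus le S H F p g 0 A \<le> p 0 G + g 0 J - g 0 B" if "C = {}"
    unfolding xi0_def v[symmetric] by (rule Inf_lower) (use t that in blast)
qed

section \<open>Extensions from minorants\<close>

definition dilations :: "(real \<times> ('x set \<Rightarrow> 'x set)) set" where
  "dilations = (\<lambda>a. (re a, (`) (scl a))) ` pos_scalars emb"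

text \<open>

  Taking \<open>{{}}\<close> and \<open>S\<close> for the family \<open>\<C>\<close> of cancellable sets gives the preorders behind \<open>\<xi>\<^sub>0\<close>
  and \<open>\<xi>\<close>, so that both parts of the theorem are instances of one statement.
\<close>

definition le_mod :: "'x set set \<Rightarrow> 'x set \<Rightarrow> 'x set \<Rightarrow> bool" where
  "le_mod \<C> A B \<longleftrightarrow> (\<exists>C\<in>\<C>. le (splus A C) (splus B C))"

lemma dilation_monoid_mod:
  assumes C: "\<C> \<subseteq> S" "{} \<in> \<C>" "\<And>C E. C \<in> \<C> \<Longrightarrow> E \<in> \<C> \<Longrightarrow> splus C E \<in> \<C>"
    "\<And>a C. a \<in> pos_scalars emb \<Longrightarrow> C \<in> \<C> \<Longrightarrow> scl a ` C \<in> \<C>"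
  shows "dilation_monoid S splus {} (le_mod \<C>) dilations"
proof
  fix A assume "A \<in> S" then show "le_mod \<C> A A"
    using C(1,2) S.le_refl S.plus_closed by (auto simp: le_mod_def intro!: bexI[of _ "{}"])
next
  fix A B E assume A: "A \<in> S" "B \<in> S" "E \<in> S" and "le_mod \<C> A B" "le_mod \<C> B E"
  then obtain C D where c: "C \<in> \<C>" "D \<in> \<C>"
    and l: "le (splus A C) (splus B C)" "le (splus B D) (splus E D)"
    by (auto simp: le_mod_def)
  have cs: "C \<in> S" "D \<in> S" using c C by auto
  have 1: "le (splus (splus A C) D) (splus (splus B C) D)"
    and 2: "le (splus (splus B D) C) (splus (splus E D) C)"
    using A cs l by (auto intro!: S.plus_mono S.plus_closed S.le_refl)
  have "le (splus A (splus C D)) (splus E (splus C D))"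
    using A cs 1 2 S.le_trans[of "splus A (splus C D)" "splus B (splus C D)" "splus E (splus C D)"]
    by (simp add: S.plus_assoc S.plus_closed S.plus_commute[of D C])
  then show "le_mod \<C> A E" using c C(3) by (auto simp: le_mod_def)
next
  fix A A' B B' assume A: "A \<in> S" "A' \<in> S" "B \<in> S" "B' \<in> S" and "le_mod \<C> A A'" "le_mod \<C> B B'"
  then obtain C D where c: "C \<in> \<C>" "D \<in> \<C>"
    and l: "le (splus A C) (splus A' C)" "le (splus B D) (splus B' D)"
    by (auto simp: le_mod_def)
  have cs: "C \<in> S" "D \<in> S" using c C by auto
  have "le (splus (splus A C) (splus B D)) (splus (splus A' C) (splus B' D))"
    using A cs l by (auto intro!: S.plus_mono S.plus_closed)
  then have "le (splus (splus A B) (splus C D)) (splus (splus A' B') (splus C D))"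
    using A cs by (simp add: splus_interchange)
  then show "le_mod \<C> (splus A B) (splus A' B')" using c C(3) by (auto simp: le_mod_def)
next
  show "(1, id) \<in> dilations"
    unfolding dilations_def using one_pos by (intro image_eqI[of _ _ 1]) (auto simp: emb_simps)
next
  fix n \<phi> A B assume d: "(n, \<phi>) \<in> dilations" and A: "A \<in> S" "B \<in> S" and "le_mod \<C> A B"
  then obtain C where c: "C \<in> \<C>" and l: "le (splus A C) (splus B C)"
    by (auto simp: le_mod_def)
  obtain a where a: "a \<in> pos_scalars emb" "\<phi> = (`) (scl a)" using d by (auto simp: dilations_def)
  have cs: "C \<in> S" using c C by auto
  have "le (scl a ` splus A C) (scl a ` splus B C)"
    using A cs l a by (intro S.scale_mono S.plus_closed pos_scalars_P)
  then show "le_mod \<C> (\<phi> A) (\<phi> B)"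
    using A c cs a C(4) by (auto simp: le_mod_def S.scale_plus pos_scalars_P)
next
  fix n \<phi> m \<psi> A assume "(n, \<phi>) \<in> dilations" "(m, \<psi>) \<in> dilations"
  then show "\<phi> (\<psi> A) = \<psi> (\<phi> A)"
    by (auto simp: dilations_def image_image mult.commute)
next
  fix A B assume "A \<in> S" "B \<in> S"
  then show "splus A B = splus B A" by (rule S.plus_commute)
next
  fix n \<phi> A B assume "(n, \<phi>) \<in> dilations" "A \<in> S" "B \<in> S"
  then show "\<phi> (splus A B) = splus (\<phi> A) (\<phi> B)"
    using S.scale_plus pos_scalars_P unfolding dilations_def by blast
qed (auto simp: dilations_def re_pos S.empty_mem S.plus_closed S.plus_assoc S.plus_empty
        S.scale_closed pos_scalars_P)

text \<open>

  The sandwich theorem gives an additive \<open>q\<close> on \<open>S\<close>, and \<open>h(x, A) = q(-x + A)\<close> is the map sought.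
  Real linearity in \<open>x\<close> includes finiteness, which comes from \<open>q{x} + q{-x} = q{0} = 0\<close> with both
  summands above \<open>-\<infinity>\<close>.

  Monotonicity with respect to \<open>le_mod \<C>\<close> is recorded separately: if \<open>h\<close> is infinite at a set of \<open>\<C>\<close>, that
  set cannot be cancelled by means of monotonicity with respect to \<open>le\<close>.
\<close>

lemma extension_above_minorant:
  assumes C: "\<C> \<subseteq> S" "{} \<in> \<C>" "\<And>C E. C \<in> \<C> \<Longrightarrow> E \<in> \<C> \<Longrightarrow> splus C E \<in> \<C>"
    "\<And>a C. a \<in> pos_scalars emb \<Longrightarrow> C \<in> \<C> \<Longrightarrow> scl a ` C \<in> \<C>"
    and \<eta>: "superlinear emb scl splus UNIV S \<eta>" "above_minus_infinity UNIV S \<eta>"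
    and test: "\<And>A B G J C. A \<in> S \<Longrightarrow> B \<in> F \<Longrightarrow> G \<in> S \<Longrightarrow> J \<in> F \<Longrightarrow> C \<in> \<C> \<Longrightarrow>
      le (splus (splus A B) C) (splus (splus G J) C) \<Longrightarrow> \<eta> 0 A \<le> p 0 G + g 0 J - g 0 B"
  obtains h where "monotone_HB_extension emb scl splus le S H F p g h" "dominated UNIV S \<eta> h"
    "\<And>x A B. A \<in> S \<Longrightarrow> B \<in> S \<Longrightarrow> le_mod \<C> A B \<Longrightarrow> h x A \<le> h x B"
proof -
  have ip: "invariant_homogeneous emb scl UNIV S p" using p by (simp add: sublinear_def)
  have ie: "invariant_homogeneous emb scl UNIV S \<eta>" using \<eta> by (simp add: superlinear_def)
  have ig: "invariant_homogeneous emb scl H F g" using g by (simp add: semilinear_def)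
  have gfin: "g 0 A = ereal (real_of_ereal (g 0 A))" if "A \<in> F" for A
    using g_fin that zero_H by (simp add: finite_map_def ereal_real)
  interpret M: dilation_monoid S splus "{}" "le_mod \<C>" dilations
    using dilation_monoid_mod[OF C] .
  interpret sandwich S splus "{}" "le_mod \<C>" dilations "p 0" "\<eta> 0" F "\<lambda>A. real_of_ereal (g 0 A)"
  proof
    show "p 0 {} = 0" "\<eta> 0 {} = 0" "real_of_ereal (g 0 {}) = 0"
      using ip ie ig by (auto simp: invariant_homogeneous_def)
    fix A B assume "A \<in> S" "B \<in> S"
    then show "p 0 (splus A B) \<le> p 0 A + p 0 B" using p by (simp add: sublinear_def)
  next
    fix A B assume "A \<in> S" "B \<in> S"
    then show "\<eta> 0 A + \<eta> 0 B \<le> \<eta> 0 (splus A B)"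
      using \<eta> by (simp add: superlinear_def above_minus_infinity_def lower_add_eq[symmetric])
  next
    fix n \<phi> A assume "(n, \<phi>) \<in> dilations" "A \<in> S"
    then show "p 0 (\<phi> A) \<le> ereal n * p 0 A" "ereal n * \<eta> 0 A \<le> \<eta> 0 (\<phi> A)"
      using ip ie by (auto simp: dilations_def invariant_homogeneous_def)
  next
    fix A assume "A \<in> S"
    then show "\<eta> 0 A \<noteq> -\<infinity>" using \<eta> by (simp add: above_minus_infinity_def)
  next
    fix A B assume AB: "A \<in> F" "B \<in> F"
    then have "g 0 (splus A B) = g 0 A + g 0 B" using g by (simp add: semilinear_def)
    then show "real_of_ereal (g 0 (splus A B)) = real_of_ereal (g 0 A) + real_of_ereal (g 0 B)"
      using gfin[OF AB(1)] gfin[OF AB(2)] by (metis plus_ereal.simps(1) real_of_ereal.simps(1))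
  next
    fix n \<phi> A assume d: "(n, \<phi>) \<in> dilations" "A \<in> F"
    then show "\<phi> A \<in> F" by (auto simp: dilations_def F.scale_closed pos_scalars_P)
    have "g 0 (\<phi> A) = ereal n * g 0 A" using ig d by (auto simp: dilations_def invariant_homogeneous_def)
    then show "real_of_ereal (g 0 (\<phi> A)) = n * real_of_ereal (g 0 A)" by simp
  next
    fix A B G J assume "A \<in> S" "B \<in> F" "G \<in> S" "J \<in> F" "le_mod \<C> (splus A B) (splus G J)"
    then show "\<eta> 0 A \<le> p 0 G + ereal (real_of_ereal (g 0 J)) - ereal (real_of_ereal (g 0 B))"
      using test gfin by (auto simp: le_mod_def)
  qed (auto simp: F_S F.empty_mem F.plus_closed)
  obtain q where q: "\<And>A. A \<in> S \<Longrightarrow> q A \<noteq> -\<infinity>"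
    "\<And>A B. A \<in> S \<Longrightarrow> B \<in> S \<Longrightarrow> q (splus A B) = q A + q B"
    "\<And>n \<phi> A. (n, \<phi>) \<in> dilations \<Longrightarrow> A \<in> S \<Longrightarrow> q (\<phi> A) = ereal n * q A"
    "\<And>A B. A \<in> S \<Longrightarrow> B \<in> S \<Longrightarrow> le_mod \<C> A B \<Longrightarrow> q A \<le> q B"
    "\<And>A. A \<in> F \<Longrightarrow> q A = ereal (real_of_ereal (g 0 A))"
    "\<And>A. A \<in> S \<Longrightarrow> \<eta> 0 A \<le> q A"
    "\<And>A. A \<in> S \<Longrightarrow> q A \<le> p 0 A"
    using additive_between by blast
  have tS: "translate v A \<in> S" if "A \<in> S" for v A using S.translate_closed that by simp
  define h where "h x A = q (translate (- x) A)" for x A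
  have q_g: "q A = g 0 A" if "A \<in> F" for A using q(5) gfin that by simp
  have q_empty: "q {} = 0" using q_g F.empty_mem ig by (simp add: invariant_homogeneous_def)
  have "g (0 + 0) (translate 0 {}) = g 0 {}"
    using ig zero_H F.empty_mem unfolding invariant_homogeneous_def by blast
  then have q_0: "q {0} = 0"
    using q_g[of "{0}"] F.translate_closed[OF zero_H F.empty_mem] q_empty q_g[OF F.empty_mem]
    by (simp add: translate_empty)
  \<comment> \<open>The translate of \<open>{}\<close> by \<open>0\<close> is \<open>{0}\<close>, not \<open>{}\<close>; but \<open>q\<close> vanishes at both, since
    \<open>{0}\<close> belongs to \<open>F\<close> and \<open>g\<close> is translation invariant.\<close>
  have h_0: "h 0 A = q A" for A
    using q_0 q_empty by (cases "A = {}") (simp_all add: h_def translate_zero translate_empty)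
  have q_scl: "q (scl a ` A) = scalar_val emb a * q A" if "a \<in> pos_scalars emb" "A \<in> S" for a A
    using q(3)[of "re a" "(`) (scl a)" A] that by (auto simp: dilations_def)
  have h_empty: "h x {} = q {- x}" for x by (simp add: h_def translate_empty)
  have q_plus: "q {x + y} = q {x} + q {y}" for x y
    using q(2)[OF singleton_S singleton_S, of x y] S.translate_plus[OF _ singleton_S, of x y]
    by (simp add: translate_def)
  have q_fin: "\<bar>q {x}\<bar> \<noteq> \<infinity>" for x
    using q_plus[of x "- x"] q_0 q(1)[OF singleton_S, of x] q(1)[OF singleton_S, of "- x"]
    by (cases "q {x}"; cases "q {- x}") auto
  have q_neg: "q {- x} = - q {x}" for x
    using q_plus[of x "- x"] q_0 q_fin[of x] q_fin[of "- x"]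
    by (cases "q {x}"; cases "q {- x}") auto
  have lin: "real_linear emb scl UNIV (\<lambda>x. h x {})"
    unfolding real_linear_def
  proof (intro conjI ballI allI impI)
    fix x y show "\<bar>h x {}\<bar> \<noteq> \<infinity>" "h (x + y) {} = h x {} + h y {}"
      using q_fin q_plus[of "- x" "- y"] by (auto simp: h_empty add.commute)
  next
    fix a x assume a: "emb a \<in> \<real>"
    consider "re a = 0" | "a \<in> pos_scalars emb" | "- a \<in> pos_scalars emb"
      using a by (cases "re a" "0::real" rule: linorder_cases) (auto simp: pos_scalars_def emb_simps)
    then show "h (scl a x) {} = scalar_val emb a * h x {}"
    proof cases
      case 1
      then have "a = 0" using a emb_eq_0 by (metis of_real_Re of_real_0)
      then show ?thesis using q_0 by (simp add: h_empty emb_simps zero_ereal_def[symmetric])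
    next
      case 2
      then show ?thesis using q_scl[OF 2 singleton_S, of "- x"] by (simp add: h_empty)
    next
      case 3
      then show ?thesis using q_scl[OF 3 singleton_S, of x] q_neg[of x] q_fin[of x]
        by (cases "q {x}") (auto simp: h_empty emb_simps)
    qed
  qed
  have inv: "invariant_homogeneous emb scl UNIV S h"
    unfolding invariant_homogeneous_def
    by (auto simp: h_0 q_empty q_scl) (simp add: h_def translate_translate)
  have mono: "h x A \<le> h x B" if A: "A \<in> S" "B \<in> S" and l: "le_mod \<C> A B" for x A B
  proof -
    obtain C where c: "C \<in> \<C>" "le (splus A C) (splus B C)" using l by (auto simp: le_mod_def)
    then have cs: "C \<in> S" using C by auto
    have "le (translate (- x) (splus A C)) (translate (- x) (splus B C))"
      using A cs c singleton_S
      by (simp add: S.translate_plus S.plus_closed S.plus_mono S.le_refl)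
    then have "le_mod \<C> (translate (- x) A) (translate (- x) B)"
      using A cs c by (auto simp: le_mod_def translate_splus)
    then show ?thesis using A q(4) tS by (simp add: h_def)
  qed
  have p_at_0: "p x A = p 0 (translate (- x) A)" and \<eta>_at_0: "\<eta> x A = \<eta> 0 (translate (- x) A)"
    if "A \<in> S" for x A
    using invariant_at_0[OF ip _ _ that] invariant_at_0[OF ie _ _ that] by blast+
  show thesis
  proof (rule that[OF _ _ mono])
    show "dominated UNIV S \<eta> h"
      using q(6) tS unfolding dominated_def h_def by (metis \<eta>_at_0)
    have "monotone_functional le UNIV S h"
      unfolding monotone_functional_def pair_le_def
      using C(2) by (auto intro!: mono bexI[of _ "{}"] simp: le_mod_def S.plus_empty)
    moreover have "h x A = g x A" if "x \<in> H" "A \<in> F" for x A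
      using invariant_at_0[OF ig that(1) uminus_H that(2)] q_g uminus_H F.translate_closed that
      by (simp add: h_def)
    moreover have "above_minus_infinity UNIV S h"
      using q(1) tS by (auto simp: above_minus_infinity_def h_def)
    moreover have "dominated UNIV S h p"
      using q(7) tS unfolding dominated_def h_def by (metis p_at_0)
    ultimately show "monotone_HB_extension emb scl splus le S H F p g h"
      using inv lin q(1,2) tS
      by (auto simp: monotone_HB_extension_def semilinear_def h_0 above_minus_infinity_def)
  qed
qed

lemma extension_above_minorant_xi0:
  assumes \<eta>: "superlinear emb scl splus UNIV S \<eta>" "above_minus_infinity UNIV S \<eta>"
    "dominated UNIV S \<eta> (xi0 emb scl splus le S H F p g)"
  obtains h where "monotone_HB_extension emb scl splus le S H F p g h" "dominated UNIV S \<eta> h"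
proof (rule extension_above_minorant[of "{{}}", OF _ _ _ _ \<eta>(1,2)])
  fix A B G J C assume *: "A \<in> S" "B \<in> F" "G \<in> S" "J \<in> F" "C \<in> {{}}"
      "le (splus (splus A B) C) (splus (splus G J) C)"
  have "\<eta> 0 A \<le> xi0 emb scl splus le S H F p g 0 A" using \<eta>(3) * by (simp add: dominated_def)
  also have "\<dots> \<le> p 0 G + g 0 J - g 0 B" using xi_le_test_value_at_0(2)[OF *(1-4) _ *(6)] *(5) S.empty_mem by blast
  finally show "\<eta> 0 A \<le> p 0 G + g 0 J - g 0 B" .
qed (use that S.empty_mem in \<open>auto simp: S.plus_empty\<close>)

lemma extension_above_minorant_xi:
  assumes \<eta>: "superlinear emb scl splus UNIV S \<eta>" "above_minus_infinity UNIV S \<eta>"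
    "dominated UNIV S \<eta> (xi emb scl splus le S H F p g)"
  obtains h where "monotone_HB_extension emb scl splus le S H F p g h" "dominated UNIV S \<eta> h"
    "dominated UNIV S h (xi emb scl splus le S H F p g)"
proof (rule extension_above_minorant[of S, OF _ _ _ _ \<eta>(1,2)])
  fix A B G J C assume *: "A \<in> S" "B \<in> F" "G \<in> S" "J \<in> F" "C \<in> S"
      "le (splus (splus A B) C) (splus (splus G J) C)"
  have "\<eta> 0 A \<le> xi emb scl splus le S H F p g 0 A" using \<eta>(3) * by (simp add: dominated_def)
  also have "\<dots> \<le> p 0 G + g 0 J - g 0 B" using xi_le_test_value_at_0(1)[OF *] by simp
  finally show "\<eta> 0 A \<le> p 0 G + g 0 J - g 0 B" .
next
  fix h assume h: "monotone_HB_extension emb scl splus le S H F p g h" "dominated UNIV S \<eta> h"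
    "\<And>x A B. A \<in> S \<Longrightarrow> B \<in> S \<Longrightarrow> le_mod S A B \<Longrightarrow> h x A \<le> h x B"
  have "dominated UNIV S h (xi emb scl splus le S H F p g)"
    unfolding dominated_def xi_def
  proof (intro ballI Inf_greatest; clarify)
    fix x A y l m B J G C ts
    assume A: "A \<in> S" and t: "test_relation emb scl splus le S H F x A y l m B J G C ts"
    then have "C \<in> S" by (simp add: test_relation_def)
    then show "h x A \<le> test_value emb p g y l m B J G ts"
      by (intro extension_le_test_value[OF h(1) _ A t] h(3)) (auto simp: le_mod_def)
  qed
  with h show thesis using that by blast
qed (auto simp: S.empty_mem S.plus_closed S.scale_closed pos_scalars_P)

lemma extension_le_xi0:
  assumes h: "monotone_HB_extension emb scl splus le S H F p g h"
  shows "dominated UNIV S h (xi0 emb scl splus le S H F p g)"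
  unfolding dominated_def xi0_def
proof (intro ballI Inf_greatest; clarify)
  fix x A y l m B J G ts
  assume A: "A \<in> S" and t: "test_relation emb scl splus le S H F x A y l m B J G {} ts"
  have "h 0 A \<le> h 0 B" if "A \<in> S" "B \<in> S" "le (splus A {}) (splus B {})" for A B
    using h that
    by (simp add: monotone_HB_extension_def monotone_functional_def pair_le_def S.plus_empty)
  then show "h x A \<le> test_value emb p g y l m B J G ts"
    by (rule extension_le_test_value[OF h _ A t])
qed

section \<open>Finiteness and cancellation\<close>

lemma finite_extension_cancel:
  assumes h: "finite_HB_extension emb scl splus le S H F p g h"
    and A: "A \<in> S" "B \<in> S" "C \<in> S" "le (splus A C) (splus B C)"
  shows "h 0 A \<le> h 0 B"
proof -
  have m: "monotone_HB_extension emb scl splus le S H F p g h" and "\<bar>h 0 C\<bar> \<noteq> \<infinity>"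
    using h A by (auto simp: finite_HB_extension_def finite_map_def)
  then have "h 0 (splus A C) \<le> h 0 (splus B C)"
    using A by (simp add: monotone_HB_extension_def monotone_functional_def pair_le_def S.plus_closed)
  then have "h 0 A + h 0 C \<le> h 0 B + h 0 C"
    using m A by (simp add: monotone_HB_extension_def semilinear_def)
  then show ?thesis using \<open>\<bar>h 0 C\<bar> \<noteq> \<infinity>\<close> by (cases "h 0 A"; cases "h 0 B"; cases "h 0 C") auto
qed

lemma finite_extension_le_xi:
  assumes h: "finite_HB_extension emb scl splus le S H F p g h"
  shows "dominated UNIV S h (xi emb scl splus le S H F p g)"
  unfolding dominated_def xi_def
proof (intro ballI Inf_greatest; clarify)
  fix x A y l m B J G C ts
  assume A: "A \<in> S" and t: "test_relation emb scl splus le S H F x A y l m B J G C ts"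
  have "C \<in> S" using t by (simp add: test_relation_def)
  with A t show "h x A \<le> test_value emb p g y l m B J G ts"
    using h by (intro extension_le_test_value) (auto simp: finite_HB_extension_def intro: finite_extension_cancel[OF h])
qed

lemma finite_on_hereditary_face:
  assumes h: "monotone_HB_extension emb scl splus le S H F p g h"
    and Q: "Q \<subseteq> UNIV \<times> S" "\<And>z C. (z, C) \<in> Q \<Longrightarrow> h z C < \<infinity>"
    and face: "(x, A) \<in> hereditary_face splus le UNIV S Q"
  shows "\<bar>h x A\<bar> \<noteq> \<infinity>"
proof -
  have hS: "semilinear emb scl splus UNIV S h" and nm: "\<And>x A. A \<in> S \<Longrightarrow> h x A \<noteq> -\<infinity>"
    using h by (auto simp: monotone_HB_extension_def above_minus_infinity_def)
  obtain y B C where *: "A \<in> S" "B \<in> S" "(x + y, C) \<in> Q" "le (splus A B) C"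
    using face by (auto simp: hereditary_face_def pair_le_def pair_plus_def)
  have "C \<in> S" using * Q by auto
  have split: "h x A = h x {} + h 0 A" if "A \<in> S" for x A
    by (rule split_position[OF hS subset_refl S.translate_closed S.empty_mem UNIV_I UNIV_I that])
  have "h (x + y) (splus A B) \<le> h (x + y) C"
    using h * \<open>C \<in> S\<close> by (simp add: monotone_HB_extension_def monotone_functional_def pair_le_def S.plus_closed)
  then have "h (x + y) (splus A B) < \<infinity>" using Q(2)[OF *(3)] by (rule le_less_trans)
  then have sum: "h (x + y) {} + (h 0 A + h 0 B) < \<infinity>"
    using split[OF S.plus_closed[OF *(1,2)], of "x + y"] hS * by (simp add: semilinear_def)
  have fin: "\<bar>h z {}\<bar> \<noteq> \<infinity>" for z
    using hS by (simp add: semilinear_def real_linear_def)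
  have "h 0 A \<noteq> \<infinity>"
    using sum fin[of "x + y"] nm[OF *(2), of 0] by (cases "h (x + y) {}"; cases "h 0 B") simp_all
  then show ?thesis
    using split[OF *(1), of x] nm[OF *(1), of 0] fin[of x]
    by (cases "h x {}"; cases "h 0 A") simp_all
qed

text \<open>

  For a translate \<open>B\<close> of \<open>A\<close> that contains \<open>0\<close> one has \<open>{0} \<le> {0} + B = B\<close>, hence \<open>B = {0}\<close>.
\<close>

lemma equality_imp_singletons:
  assumes eq: "\<forall>A\<in>S. \<forall>B\<in>S. le A B \<longleftrightarrow> A = B" and A: "A \<in> S" "a \<in> A"
  shows "A = {a}"
proof -
  let ?B = "translate (- a) A"
  have B: "?B \<in> S" "0 \<in> ?B" using A S.translate_closed by (auto simp: translate_def intro!: image_eqI[of _ _ a])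
  have "le {0} (splus {0} ?B)" using S.le_plus[OF singleton_S B(1) _ B(2)] by simp
  then have "{0} = splus {0} ?B"
    using eq singleton_S S.plus_closed[OF singleton_S B(1)] by simp
  also have "\<dots> = translate 0 ?B" using S.translate_plus[OF _ B(1), of 0] by simp
  also have "\<dots> = ?B" using B(2) by (intro translate_zero) auto
  finally have 1: "(\<lambda>b. - a + b) ` A = {0}" using A(2) by (simp add: translate_def split: if_splits)
  have "b = a" if "b \<in> A" for b
  proof -
    have "- a + b \<in> {0}" unfolding 1[symmetric] using that by (rule imageI)
    then show ?thesis using add_eq_0_iff[of "- a" b] by simp
  qed
  with A(2) show ?thesis by blast
qed

lemma equality_imp_finite:
  assumes eq: "\<forall>A\<in>S. \<forall>B\<in>S. le A B \<longleftrightarrow> A = B"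
    and h: "monotone_HB_extension emb scl splus le S H F p g h"
  shows "finite_map UNIV S h"
  unfolding finite_map_def
proof (intro ballI)
  fix x A assume A: "A \<in> S"
  have hS: "semilinear emb scl splus UNIV S h" using h by (simp add: monotone_HB_extension_def)
  then have fin: "\<bar>h y {}\<bar> \<noteq> \<infinity>" for y by (auto simp: semilinear_def real_linear_def)
  show "\<bar>h x A\<bar> \<noteq> \<infinity>"
  proof (cases "A = {}")
    case False
    then obtain a where a: "A = {a}" using equality_imp_singletons[OF eq A] by blast
    have inv: "invariant_homogeneous emb scl UNIV S h" using hS by (simp add: semilinear_def)
    have "h (a + (x - a)) (translate a {}) = h (x - a) {}"
      using inv S.empty_mem unfolding invariant_homogeneous_def by blast
    then show ?thesis using fin by (simp add: a translate_empty)
  qed (simp add: fin)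
qed

lemma finite_extension_imp_cancellative:
  assumes h: "finite_HB_extension emb scl splus le S H F p g h"
  shows "cancellative splus S H F g"
  unfolding cancellative_def
proof (intro ballI impI)
  fix x A B assume A: "x \<in> H" "A \<in> F" "B \<in> F" and "\<exists>C\<in>S. splus A C = splus B C"
  then obtain C where C: "C \<in> S" "splus A C = splus B C" by blast
  have "le (splus A C) (splus B C)" "le (splus B C) (splus A C)"
    using S.le_refl[OF S.plus_closed[OF mem_F C(1)]] A C(2) by metis+
  then have "h 0 A = h 0 B"
    using A C(1) mem_F by (intro order_antisym finite_extension_cancel[OF h]) auto
  then have "g 0 A = g 0 B"
    using h A zero_H by (simp add: finite_HB_extension_def monotone_HB_extension_def)
  moreover have split: "g x A = g x {} + g 0 A" if "A \<in> F" for A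
    using split_position[OF g F_S F.translate_closed F.empty_mem A(1) uminus_H[OF A(1)] that] .
  ultimately show "g x A = g x B" using split[OF A(2)] split[OF A(3)] by argo
qed

end

section \<open>The extension theorem\<close>

theorem theorem2p8:
  fixes emb :: "'k::field \<Rightarrow> complex"
    and scl :: "'k \<Rightarrow> 'x::topological_ab_group_add \<Rightarrow> 'x"
    and P :: "'k set"
    and splus :: "'x set \<Rightarrow> 'x set \<Rightarrow> 'x set"
    and le :: "'x set \<Rightarrow> 'x set \<Rightarrow> bool"
    and S F :: "'x set set"
    and H :: "'x set"
    and p g \<xi> \<xi>\<^sub>0 :: "'x \<Rightarrow> 'x set \<Rightarrow> ereal"
  assumes "scalar_embedding emb"
    and "topological_vector_space emb scl"
    and "P = UNIV - {0} \<or> P = pos_scalars emb"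
    and "quasisemilinear_preordered_space scl P splus le UNIV S"
    and "module.subspace scl H"
    and "F \<subseteq> S"
    and "quasisemilinear_preordered_space scl P splus le H F"
    and "sublinear emb scl splus UNIV S p"
    and "finite_map H F g"
    and "semilinear emb scl splus H F g"
    and "monotone_functional le H F g"
    and "dominated H F g p"
    and "\<xi> = xi emb scl splus le S H F p g"
    and "\<xi>\<^sub>0 = xi0 emb scl splus le S H F p g"
  shows
    "(hereditary_face splus le UNIV S ((H \<times> F) \<union> {(x, C). C \<in> S \<and> p x C < \<infinity>}) = UNIV \<times> S \<or>
      hereditary_face splus le UNIV S {(x, C). C \<in> S \<and> \<xi> x C < \<infinity>} = UNIV \<times> S
      \<longrightarrow>
      ((\<exists>h. finite_HB_extension emb scl splus le S H F p g h) \<longleftrightarrow>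
       (\<exists>\<eta>. superlinear emb scl splus UNIV S \<eta> \<and> finite_map UNIV S \<eta> \<and>
            dominated UNIV S \<eta> \<xi>)) \<and>
      (\<forall>\<eta>. superlinear emb scl splus UNIV S \<eta> \<and> finite_map UNIV S \<eta> \<and> dominated UNIV S \<eta> \<xi>
         \<longrightarrow> (\<exists>h. finite_HB_extension emb scl splus le S H F p g h \<and>
                  dominated UNIV S \<eta> h \<and> dominated UNIV S h \<xi>)))
     \<and>
     (((\<exists>h. monotone_HB_extension emb scl splus le S H F p g h) \<longleftrightarrow>
       (\<exists>\<eta>. superlinear emb scl splus UNIV S \<eta> \<and> above_minus_infinity UNIV S \<eta> \<and>
            dominated UNIV S \<eta> \<xi>\<^sub>0)) \<and>
      (\<forall>\<eta>. superlinear emb scl splus UNIV S \<eta> \<and> above_minus_infinity UNIV S \<eta> \<and>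
            dominated UNIV S \<eta> \<xi>\<^sub>0
         \<longrightarrow> (\<exists>h. monotone_HB_extension emb scl splus le S H F p g h \<and>
                  dominated UNIV S \<eta> h \<and> dominated UNIV S h \<xi>\<^sub>0)))
     \<and>
     ((\<forall>A\<in>S. \<forall>B\<in>S. le A B \<longleftrightarrow> A = B)
      \<longrightarrow>
      ((\<exists>h. finite_HB_extension emb scl splus le S H F p g h) \<longleftrightarrow>
       (\<exists>\<eta>. superlinear emb scl splus UNIV S \<eta> \<and> above_minus_infinity UNIV S \<eta> \<and>
            dominated UNIV S \<eta> \<xi>\<^sub>0) \<and>
       cancellative splus S H F g))"
proof -
  have vs: "vector_space scl" using assms(2) by (simp add: topological_vector_space_def)
  interpret hahn_banach_problem emb scl P splus le S H F p g
    unfolding hahn_banach_problem_def hahn_banach_problem_axioms_def using assms vs by blast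
  let ?mono = "monotone_HB_extension emb scl splus le S H F p g"
  let ?fin = "finite_HB_extension emb scl splus le S H F p g"
  let ?Q = "(H \<times> F) \<union> {(x, C). C \<in> S \<and> p x C < \<infinity>}" and ?R = "{(x, C). C \<in> S \<and> \<xi> x C < \<infinity>}"
  let ?super = "superlinear emb scl splus UNIV S"
  have mono_super: "?super h \<and> above_minus_infinity UNIV S h \<and> dominated UNIV S h \<xi>\<^sub>0"
    if "?mono h" for h
    using that semilinear_imp_superlinear[of emb scl splus UNIV S h] extension_le_xi0[OF that] assms(14)
    by (simp add: monotone_HB_extension_def)
  have fin_super: "?super h \<and> finite_map UNIV S h \<and> dominated UNIV S h \<xi>" if "?fin h" for h
    using that semilinear_imp_superlinear[of emb scl splus UNIV S h]
      finite_extension_le_xi[OF that] assms(13)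
    by (simp add: monotone_HB_extension_def finite_HB_extension_def)
  have ii: "\<exists>h. ?mono h \<and> dominated UNIV S \<eta> h \<and> dominated UNIV S h \<xi>\<^sub>0"
    if "?super \<eta>" "above_minus_infinity UNIV S \<eta>" "dominated UNIV S \<eta> \<xi>\<^sub>0" for \<eta>
    using extension_above_minorant_xi0[of \<eta>] that mono_super assms(14) by metis
  have i: "\<exists>h. ?fin h \<and> dominated UNIV S \<eta> h \<and> dominated UNIV S h \<xi>"
    if face: "hereditary_face splus le UNIV S ?Q = UNIV \<times> S \<or> hereditary_face splus le UNIV S ?R = UNIV \<times> S"
      and \<eta>: "?super \<eta>" "finite_map UNIV S \<eta>" "dominated UNIV S \<eta> \<xi>" for \<eta>
  proof -
    have "above_minus_infinity UNIV S \<eta>"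
      using \<eta>(2) unfolding above_minus_infinity_def finite_map_def by (metis abs_ereal.simps)
    then obtain h where h: "?mono h" "dominated UNIV S \<eta> h" "dominated UNIV S h \<xi>"
      using extension_above_minorant_xi[of \<eta>] \<eta> assms(13) by blast
    have 1: "h x C < \<infinity>" if "(x, C) \<in> ?Q" for x C
      using that
    proof
      assume "(x, C) \<in> H \<times> F"
      then have "h x C = g x C" "\<bar>g x C\<bar> \<noteq> \<infinity>"
        using h(1) assms(9) by (simp_all add: monotone_HB_extension_def finite_map_def)
      then show ?thesis by (cases "g x C") simp_all
    next
      assume "(x, C) \<in> {(x, C). C \<in> S \<and> p x C < \<infinity>}"
      then have "h x C \<le> p x C" "p x C < \<infinity>"
        using h(1) unfolding monotone_HB_extension_def dominated_def by blast+
      then show ?thesis by (rule le_less_trans)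
    qed
    have 2: "h x C < \<infinity>" if "(x, C) \<in> ?R" for x C
    proof -
      have "h x C \<le> \<xi> x C" "\<xi> x C < \<infinity>" using that h(3) unfolding dominated_def by blast+
      then show ?thesis by (rule le_less_trans)
    qed
    have "\<bar>h x A\<bar> \<noteq> \<infinity>" if A: "A \<in> S" for x A
      using face
    proof
      assume f: "hereditary_face splus le UNIV S ?Q = UNIV \<times> S"
      show ?thesis
        by (rule finite_on_hereditary_face[OF h(1), where Q = ?Q])
          (use A f mem_F in \<open>blast intro: 1\<close>)+
    next
      assume f: "hereditary_face splus le UNIV S ?R = UNIV \<times> S"
      show ?thesis
        by (rule finite_on_hereditary_face[OF h(1), where Q = ?R])
          (use A f in \<open>blast intro: 2\<close>)+
    qed
    then have "?fin h" using h(1) by (simp add: finite_HB_extension_def finite_map_def)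
    then show ?thesis using h by blast
  qed
  have iii: "?fin h" if "\<forall>A\<in>S. \<forall>B\<in>S. le A B \<longleftrightarrow> A = B" "?mono h" for h
    using equality_imp_finite[OF that] that(2) by (simp add: finite_HB_extension_def)
  have fin_mono: "?mono h" if "?fin h" for h using that by (simp add: finite_HB_extension_def)
  have 3: "(\<exists>h. ?fin h) \<longleftrightarrow>
       (\<exists>\<eta>. ?super \<eta> \<and> above_minus_infinity UNIV S \<eta> \<and> dominated UNIV S \<eta> \<xi>\<^sub>0) \<and>
       cancellative splus S H F g" if "\<forall>A\<in>S. \<forall>B\<in>S. le A B \<longleftrightarrow> A = B"
    using finite_extension_imp_cancellative mono_super fin_mono ii iii[OF that] by meson
  show ?thesis
    by (intro conjI impI)
      ((use i fin_super in meson), (use i in meson), (use ii mono_super in meson),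
       (use ii in meson), (use 3 in simp))
qed

end
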